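(* Fix $h\in\mathbb C^\times$, let $U\subseteq\mathbb C$ be half-step-invariant, let $X:U\to\mathbb C$ be an admissible map, and let $D,S:\mathcal P\to\mathcal P$ be the associated divided-difference and averaging operators, with transposes $\mathbf D,\mathbf S:\mathcal P'\to\mathcal P'$. Let $\mathbf u\in\mathcal P'$ be such that $\langle\mathbf u,1\rangle\neq0$, and assume that there exist polynomials $\phi(x)=\phi_2x^2+\phi_1x+\phi_0$ and $\psi(x)=\psi_1x+\psi_0$, not both identically zero, such that $$\mathbf D(\phi\,\mathbf u)=\mathbf S(\psi\,\mathbf u)$$ in $\mathcal P'$. Assume that $X$ belongs to the $q$-exponential branch, and that a fixed global characteristic root $q$ is a primitive $\nu$-th root of unity with $\nu\ge3$. Let $q^{1/2}$ be the half-step-compatible square root, fix $s_0\in U$, let $c,a_{s_0},b_{s_0}$ be the constants in $X(s_0+kh)=a_{s_0}q^k+b_{s_0}q^{-k}+c$ ($k\in\mathbb Z$), and put $\Pi=a_{s_0}b_{s_0}$ (independent of the chosen progression). Set $$\alpha_n=\frac{q^{n/2}+q^{-n/2}}2,\qquad \gamma_n=\frac{q^{n/2}-q^{-n/2}}{q^{1/2}-q^{-1/2}},\qquad \alpha=\alpha_1,$$ $$d_n=\phi_2\gamma_n+\psi_1\alpha_n,\qquad e_n=(2\phi_2c+\phi_1)\gamma_n+(\psi_1c+\psi_0)\alpha_n,$$ $$\phi^{[n]}(x)=\bigl(\psi_1(\alpha^2-1)\gamma_{2n}+\phi_2\alpha_{2n}\bigr)\bigl((x-c)^2-2\Pi\bigr)+\bigl(\phi'(c)\alpha_n+\psi(c)(\alpha^2-1)\gamma_n\bigr)(x-c)+\phi(c)+2\phi_2\Pi.$$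 Let $N\in\mathbb N$ with $N+1<\nu$, and assume that $$d_j\neq0,\qquad j=0,1,\dots,2N+1.$$ Then $\mathbf u$ is regular of order $N+2$ if and only if $$\phi^{[n]}\!\left(c-\frac{e_n}{d_{2n}}\right)\neq0,\qquad n=0,1,\dots,N.$$ Whenever this holds, the corresponding monic orthogonal polynomial sequence $P_0,\dots,P_{N+1}$ satisfies $P_{-1}=0$, $P_0=1$, $P_{n+1}(x)=(x-B_n)P_n(x)-C_nP_{n-1}(x)$ for $n=0,\dots,N$ (the term $C_0P_{-1}$ being void), with $$B_0=c-\frac{\gamma_1e_0}{d_0},\qquad C_1=-\frac{\gamma_1}{d_1}\,\phi^{[0]}\!\left(c-\frac{e_0}{d_0}\right),$$ and, for $n=1,\dots,N$, $$B_n=c+\frac{\gamma_ne_{n-1}}{d_{2n-2}}-\frac{\gamma_{n+1}e_n}{d_{2n}},\qquad C_{n+1}=-\frac{\gamma_{n+1}d_{n-1}}{d_{2n-1}d_{2n+1}}\,\phi^{[n]}\!\left(c-\frac{e_n}{d_{2n}}\right),$$ where $C_{N+1}$ is the terminal norm coefficient $\langle\mathbf u,P_{N+1}^2\rangle/\langle\mathbf u,P_N^2\rangle$.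
   Context: $\mathbb N=\{0,1,2,\dots\}$, $\mathbb C^\times=\mathbb C\setminus\{0\}$. Fix $h\in\mathbb C^\times$. A non-empty set $U\subseteq\mathbb C$ is half-step-invariant if $U\pm\frac h2\subseteq U$. For $X:U\to\mathbb C$ put $Y(s)=X(s+\frac h2)$, $Z(s)=X(s-\frac h2)$, $Y_1(s)=X(s+h)$, $Z_1(s)=X(s-h)$. $X$ is parametrising if $Y-Z$ vanishes nowhere on $U$; it is admissible if moreover $X(U)$ is infinite and for every complex polynomial $p$ of degree $\ge1$ there is a polynomial $Q$ with $\deg Q\le\deg p-1$ and $\frac{p(Y)-p(Z)}{Y-Z}=Q(X)$ throughout $U$. $\mathcal P$ is the space of complex polynomials, the inductive limit of the finite-dimensional spaces $\mathcal P_n$ of polynomials of degree at most $n$; its continuous dual $\mathcal P'$ coincides with the space of all linear functionals on $\mathcal P$. For admissible $X$, $Dp$ and $Sp$ are the unique polynomials with $(Dp)(X)=\frac{p(Y)-p(Z)}{Y-Z}$ and $(Sp)(X)=\frac{p(Y)+p(Z)}2$ throughout $U$. On $\mathcal P'$: $\langle p_0\mathbf u,p\rangle=\langle\mathbf u,p_0p\rangle$, $\langle\mathbf D\mathbf u,p\rangle=-\langle\mathbf u,Dp\rangle$, $\langle\mathbf S\mathbf u,p\rangle=\langle\mathbf u,Sp\rangle$. A family $(P_n)_{n\in I}$ with $\deg P_n=n$ is orthogonal with respect to $\mathbf u$ if $\langle\mathbf u,P_nP_m\rangle=0$ for $m,n\in I$, $m<n$, and $\langle\mathbf u,P_n^2\rangle\neq0$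 for $n\in I$. $\mathbf u$ is regular of order $M+1$ if there is an orthogonal polynomial sequence $P_0,\dots,P_M$ with respect to $\mathbf u$. Branch data (known facts for admissible $X$): there are unique constants $\eta,\beta\in\mathbb C$ with $Y+Z=\eta X+\beta$ throughout $U$, and then $Y_1+Z_1=AX+B$ with $A=\eta^2-2$, $B=(\eta+2)\beta$. $X$ belongs to the $q$-exponential branch if $\eta\notin\{0,2,-2\}$ (equivalently $A^2\neq4$). The global characteristic roots are the two solutions $q$ of $q+q^{-1}=A$. Once $q$ is fixed, the half-step-compatible root $q^{1/2}$ is the unique square root of $q$ with $q^{1/2}+q^{-1/2}=\eta$, and $q^{n/2}=(q^{1/2})^n$ for $n\in\mathbb Z$. For every $s_0\in U$ there are unique $a_{s_0},b_{s_0}\in\mathbb C$ with $X(s_0+kh)=a_{s_0}q^k+b_{s_0}q^{-k}+c$ for all $k\in\mathbb Z$, where $c=B/(2-A)$ does not depend on $s_0$; the product $a_{s_0}b_{s_0}$ does not depend on $s_0$. *)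

theory Defs
  imports Complex_Main "HOL-Computational_Algebra.Polynomial"
begin

text \<open>
  A map \<open>X : U \<rightarrow> \<complex>\<close> is represented by a total function of type \<^typ>\<open>complex \<Rightarrow> complex\<close>;
  half-step invariance of \<open>U\<close> guarantees that only its values on \<open>U\<close> are ever used below.
\<close>

definition half_step_invariant :: "complex \<Rightarrow> complex set \<Rightarrow> bool" where
  "half_step_invariant h U \<longleftrightarrow>
     U \<noteq> {} \<and> (\<lambda>s. s + h / 2) ` U \<subseteq> U \<and> (\<lambda>s. s - h / 2) ` U \<subseteq> U"

definition parametrising :: "complex \<Rightarrow> complex set \<Rightarrow> (complex \<Rightarrow> complex) \<Rightarrow> bool" where
  "parametrising h U X \<longleftrightarrow> (\<forall>s\<in>U. X (s + h / 2) - X (s - h / 2) \<noteq> 0)"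

definition admissible :: "complex \<Rightarrow> complex set \<Rightarrow> (complex \<Rightarrow> complex) \<Rightarrow> bool" where
  "admissible h U X \<longleftrightarrow>
     parametrising h U X \<and> infinite (X ` U) \<and>
     (\<forall>p :: complex poly. degree p \<ge> 1 \<longrightarrow>
        (\<exists>Q. degree Q \<le> degree p - 1 \<and>
           (\<forall>s\<in>U. (poly p (X (s + h / 2)) - poly p (X (s - h / 2)))
                      / (X (s + h / 2) - X (s - h / 2)) = poly Q (X s))))"

definition divdiff :: "complex \<Rightarrow> complex set \<Rightarrow> (complex \<Rightarrow> complex) \<Rightarrow> complex poly \<Rightarrow> complex poly" where
  "divdiff h U X p = (THE Q. \<forall>s\<in>U. poly Q (X s) =
     (poly p (X (s + h / 2)) - poly p (X (s - h / 2))) / (X (s + h / 2) - X (s - h / 2)))"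

definition average :: "complex \<Rightarrow> complex set \<Rightarrow> (complex \<Rightarrow> complex) \<Rightarrow> complex poly \<Rightarrow> complex poly" where
  "average h U X p = (THE Q. \<forall>s\<in>U. poly Q (X s) =
     (poly p (X (s + h / 2)) + poly p (X (s - h / 2))) / 2)"

text \<open>
  The continuous dual of the inductive limit of the finite-dimensional spaces of polynomials of
  bounded degree is the full algebraic dual, so no continuity condition is imposed.
\<close>

definition functional :: "(complex poly \<Rightarrow> complex) \<Rightarrow> bool" where
  "functional u \<longleftrightarrow> Vector_Spaces.linear smult (*) u"

definition mult_functional :: "complex poly \<Rightarrow> (complex poly \<Rightarrow> complex) \<Rightarrow> complex poly \<Rightarrow> complex" where
  "mult_functional p0 u = (\<lambda>p. u (p0 * p))"

definition divdiff_dual ::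
  "complex \<Rightarrow> complex set \<Rightarrow> (complex \<Rightarrow> complex) \<Rightarrow> (complex poly \<Rightarrow> complex) \<Rightarrow> complex poly \<Rightarrow> complex" where
  "divdiff_dual h U X u = (\<lambda>p. - u (divdiff h U X p))"

definition average_dual ::
  "complex \<Rightarrow> complex set \<Rightarrow> (complex \<Rightarrow> complex) \<Rightarrow> (complex poly \<Rightarrow> complex) \<Rightarrow> complex poly \<Rightarrow> complex" where
  "average_dual h U X u = (\<lambda>p. u (average h U X p))"

definition orthogonal_family :: "nat set \<Rightarrow> (complex poly \<Rightarrow> complex) \<Rightarrow> (nat \<Rightarrow> complex poly) \<Rightarrow> bool" where
  "orthogonal_family I u P \<longleftrightarrow>
     (\<forall>n\<in>I. degree (P n) = n) \<and>
     (\<forall>m\<in>I. \<forall>n\<in>I. m < n \<longrightarrow> u (P n * P m) = 0) \<and>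
     (\<forall>n\<in>I. u (P n ^ 2) \<noteq> 0)"

text \<open>Regularity of order \<open>M + 1\<close> concerns the members with indices \<open>0, \<dots>, M\<close>.\<close>

definition regular_of_order :: "nat \<Rightarrow> (complex poly \<Rightarrow> complex) \<Rightarrow> bool" where
  "regular_of_order m u \<longleftrightarrow> (\<exists>P. orthogonal_family {..<m} u P)"

definition monic_orthogonal_family :: "nat set \<Rightarrow> (complex poly \<Rightarrow> complex) \<Rightarrow> (nat \<Rightarrow> complex poly) \<Rightarrow> bool" where
  "monic_orthogonal_family I u P \<longleftrightarrow> orthogonal_family I u P \<and> (\<forall>n\<in>I. lead_coeff (P n) = 1)"

definition primitive_root_of_unity :: "nat \<Rightarrow> complex \<Rightarrow> bool" where
  "primitive_root_of_unity n q \<longleftrightarrow> n \<ge> 1 \<and> q ^ n = 1 \<and> (\<forall>k. 0 < k \<and> k < n \<longrightarrow> q ^ k \<noteq> 1)"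

end

theory Submission
  imports Defs
begin

text \<open>
  After translating \<open>X\<close> by \<open>c\<close>, write \<open>E p = \<phi> Dp + \<psi> Sp\<close>, so that the equation reads \<open>u (E p) = 0\<close>
  for all \<open>p\<close>, and let \<open>U2\<close> be the polynomial with \<open>U2(X) = (Y - Z)\<^sup>2 / 4\<close>. The functional \<open>u'(p) = u (\<phi> Sp + U2 \<psi> Dp)\<close> satisfies an equation of the same kind,
  with \<open>(\<phi>, \<psi>)\<close> replaced by \<open>(\<phi>\<^sup>[\<^sup>1\<^sup>], d\<^sub>2 x + e\<^sub>1)\<close>, and \<open>u'(g Dp) = -\<alpha> u(p E g)\<close>. Iterating gives
  functionals \<open>u\<^sub>n\<close>. If \<open>P\<close> is monic of degree \<open>k + 1\<close> and orthogonal to lower degrees for \<open>u\<^sub>n\<close>, then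
  \<open>DP / \<gamma>\<^sub>k\<^sub>+\<^sub>1\<close> is so of degree \<open>k\<close> for \<open>u\<^sub>n\<^sub>+\<^sub>1\<close>. Descending to degree 0 expresses the norm of \<open>P\<close> by
  \<open>u\<^sub>n\<^sub>+\<^sub>k\<^sub>+\<^sub>1(1)\<close>, descending to degree 1 yields its subleading coefficient, and testing the equation on
  1 and on the monic polynomial of degree 1 shows that \<open>u\<^sub>n\<^sub>+\<^sub>1(1)\<close> is a nonzero multiple of
  \<open>\<phi>\<^sup>[\<^sup>n\<^sup>](c - e\<^sub>n / d\<^sub>2\<^sub>n) u\<^sub>n(1)\<close>. Only \<open>\<gamma>\<^sub>1, \<dots>, \<gamma>\<^sub>N\<^sub>+\<^sub>1\<close> are inverted, which is where \<open>N + 1 < \<nu>\<close> enters.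
\<close>

section \<open>Linear functionals and orthogonal polynomials\<close>

lemma functional_add: "functional u \<Longrightarrow> u (p + q) = u p + u q"
  unfolding functional_def by (metis Vector_Spaces.linear_iff)

lemma functional_smult: "functional u \<Longrightarrow> u (smult r p) = r * u p"
  unfolding functional_def by (metis Vector_Spaces.linear_iff)

lemma functional_0: "functional u \<Longrightarrow> u 0 = 0"
  using functional_smult[of u 0 0] by simp

lemma functional_diff: "functional u \<Longrightarrow> u (p - q) = u p - u q"
  using functional_add[of u "p - q" q] by simp

lemma functional_sum: "functional u \<Longrightarrow> u (sum f I) = (\<Sum>i\<in>I. u (f i))"
  by (induction I rule: infinite_finite_induct) (simp_all add: functional_0 functional_add)

lemmas functional_simps = functional_add functional_smult functional_0 functional_diff

lemma functionalI:
  assumes "\<And>p q. u (p + q) = u p + u q" "\<And>r p. u (smult r p) = r * u p"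
  shows "functional u"
  unfolding functional_def
  by (simp add: Vector_Spaces.linear_iff assms vector_space_def algebra_simps smult_add_right smult_add_left)

lemma functional_mult: "functional u \<Longrightarrow> functional (\<lambda>q. u (p * q))"
  by (rule functionalI) (simp_all add: functional_simps distrib_left)

lemma functional_vanishes_below:
  assumes u: "functional u"
    and P: "\<And>j. j < n \<Longrightarrow> degree (P j) = j \<and> P j \<noteq> 0 \<and> u (P j) = 0"
    and "degree q < n"
  shows "u q = 0"
  using \<open>degree q < n\<close>
proof (induction "degree q" arbitrary: q rule: less_induct)
  case less
  define k where "k = degree q"
  define r where "r = q - smult (lead_coeff q / lead_coeff (P k)) (P k)"
  have k: "k < n" and Pk: "degree (P k) = k" "P k \<noteq> 0" "u (P k) = 0"
    using less.prems P[of k] by (auto simp: k_def)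
  have "degree r \<le> k"
    unfolding r_def by (intro degree_diff_le) (use Pk in \<open>auto simp: k_def intro: degree_smult_le[THEN order_trans]\<close>)
  moreover have "coeff r k = 0"
    using Pk leading_coeff_neq_0[of "P k"] by (simp add: r_def k_def)
  ultimately have "r = 0 \<or> degree r < k"
    by (rule eq_zero_or_degree_less)
  then have "u r = 0"
    using less.hyps[of r] k by (auto simp: k_def functional_0[OF u])
  then show ?case
    by (simp add: r_def functional_simps[OF u] Pk)
qed

definition monic_orthogonal :: "(complex poly \<Rightarrow> complex) \<Rightarrow> nat \<Rightarrow> complex poly \<Rightarrow> bool" where
  "monic_orthogonal u n P \<longleftrightarrow>
     degree P = n \<and> lead_coeff P = 1 \<and> (\<forall>q. degree q < n \<longrightarrow> u (P * q) = 0)"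

lemma orthogonal_family_nonzero:
  assumes "functional u" "orthogonal_family I u P" "n \<in> I"
  shows "P n \<noteq> 0"
proof
  assume "P n = 0"
  then have "u (P n ^ 2) = 0"
    by (simp add: functional_0[OF assms(1)])
  with assms show False
    by (auto simp: orthogonal_family_def)
qed

lemma orthogonal_family_lower:
  assumes u: "functional u" and P: "orthogonal_family {..<m} u P"
    and "n < m" "degree q < n"
  shows "u (P n * q) = 0"
proof -
  have "degree (P j) = j \<and> P j \<noteq> 0 \<and> u (P n * P j) = 0" if "j < n" for j
    using that P \<open>n < m\<close> orthogonal_family_nonzero[OF u P, of j]
    by (auto simp: orthogonal_family_def)
  from functional_vanishes_below[OF functional_mult[OF u], of n P "P n" q, OF this \<open>degree q < n\<close>]
  show ?thesis by simp
qed

lemma orthogonal_family_definite: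
  assumes u: "functional u" and P: "orthogonal_family {..<m} u P"
    and "degree T < m" and T: "\<And>q. degree q \<le> degree T \<Longrightarrow> u (T * q) = 0"
  shows "T = 0"
proof (rule ccontr)
  assume "T \<noteq> 0"
  define k where "k = degree T"
  define r where "r = P k - smult (lead_coeff (P k) / lead_coeff T) T"
  have Pk: "degree (P k) = k" "P k \<noteq> 0" "u (P k ^ 2) \<noteq> 0"
    using P \<open>degree T < m\<close> orthogonal_family_nonzero[OF u P, of k]
    by (auto simp: orthogonal_family_def k_def)
  have "degree r \<le> k"
    unfolding r_def by (intro degree_diff_le) (use Pk in \<open>auto simp: k_def intro: degree_smult_le[THEN order_trans]\<close>)
  moreover have "coeff r k = 0"
    using Pk \<open>T \<noteq> 0\<close> by (simp add: r_def k_def)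
  ultimately have r: "r = 0 \<or> degree r < k"
    by (rule eq_zero_or_degree_less)
  have "u (P k * r) = 0"
    using orthogonal_family_lower[OF u P, of k r] r \<open>degree T < m\<close>
    by (auto simp: k_def functional_0[OF u])
  moreover have "u (P k * T) = 0"
    using T[of "P k"] Pk by (simp add: k_def mult.commute)
  moreover have "P k ^ 2 = P k * r + smult (lead_coeff (P k) / lead_coeff T) (P k * T)"
    by (simp add: r_def power2_eq_square algebra_simps)
  ultimately have "u (P k ^ 2) = 0"
    by (simp add: functional_simps[OF u])
  with Pk show False by simp
qed

lemma monic_orthogonal_exists:
  assumes u: "functional u" and P: "orthogonal_family {..<m} u P"
  shows "\<exists>Q. monic_orthogonal u m Q"
proof -
  define r where "r = (\<Sum>j<m. smult (u (monom 1 m * P j) / u (P j ^ 2)) (P j))"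
  define Q where "Q = monom 1 m - r"
  have deg: "degree (P j) = j" and norm: "u (P j ^ 2) \<noteq> 0" if "j < m" for j
    using P that by (auto simp: orthogonal_family_def)
  have orth: "u (P i * P j) = 0" if "i < m" "j < m" "i \<noteq> j" for i j
    using P that linorder_neqE_nat[OF \<open>i \<noteq> j\<close>]
    by (auto simp: orthogonal_family_def) (metis mult.commute lessThan_iff)
  have r: "coeff r k = 0" if "k \<ge> m" for k
    using that deg by (auto simp: r_def coeff_sum coeff_eq_0 intro!: sum.neutral)
  have coeff_Q: "coeff Q k = (if k = m then 1 else 0)" if "k \<ge> m" for k
    using that r[OF that] by (simp add: Q_def)
  have "degree Q \<le> m"
    by (rule degree_le) (use coeff_Q in auto)
  moreover have "degree Q \<ge> m"
    by (rule le_degree) (use coeff_Q[of m] in auto)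
  ultimately have dQ: "degree Q = m" by simp
  have "u (Q * P i) = 0" if i: "i < m" for i
  proof -
    have "u (r * P i) = (\<Sum>j<m. u (smult (u (monom 1 m * P j) / u (P j ^ 2)) (P j) * P i))"
      by (simp add: r_def sum_distrib_right functional_sum[OF u])
    also have "\<dots> = (\<Sum>j<m. if j = i then u (monom 1 m * P i) else 0)"
      using i orth norm by (intro sum.cong) (auto simp: functional_simps[OF u] power2_eq_square)
    also have "\<dots> = u (monom 1 m * P i)"
      using i by simp
    finally show ?thesis
      by (simp add: Q_def left_diff_distrib functional_simps[OF u])
  qed
  then have "u (Q * q) = 0" if "degree q < m" for q
    using functional_vanishes_below[OF functional_mult[OF u], of m P Q q] that deg
      orthogonal_family_nonzero[OF u P]
    by auto
  with dQ coeff_Q[of m] have "monic_orthogonal u m Q"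
    by (auto simp: monic_orthogonal_def)
  then show ?thesis ..
qed

lemma monic_orthogonal_norm:
  assumes u: "functional u" and P: "monic_orthogonal u n P"
    and "degree q \<le> n"
  shows "u (P * q) = coeff q n * u (P ^ 2)"
proof -
  define r where "r = q - smult (coeff q n) P"
  have dP: "degree P = n" "coeff P n = 1"
    using P by (auto simp: monic_orthogonal_def)
  have "degree r \<le> n"
    unfolding r_def using assms(3) dP
    by (intro degree_diff_le) (auto intro: degree_smult_le[THEN order_trans])
  moreover have "coeff r n = 0"
    using dP by (simp add: r_def)
  ultimately have "r = 0 \<or> degree r < n"
    by (rule eq_zero_or_degree_less)
  then have "u (P * r) = 0"
    using P by (auto simp: monic_orthogonal_def functional_0[OF u])
  then show ?thesis
    by (simp add: r_def right_diff_distrib functional_simps[OF u] power2_eq_square)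
qed

lemma orthogonal_family_append:
  assumes u: "functional u" and P: "orthogonal_family {..<m} u P"
    and Q: "monic_orthogonal u m Q" "u (Q ^ 2) \<noteq> 0"
  shows "orthogonal_family {..<Suc m} u (P(m := Q))"
  using P Q by (auto simp: orthogonal_family_def monic_orthogonal_def less_Suc_eq)

lemma monic_orthogonal_familyI:
  assumes u: "functional u" and P: "orthogonal_family I u P"
  shows "monic_orthogonal_family I u (\<lambda>n. smult (inverse (lead_coeff (P n))) (P n))"
proof -
  have "coeff (P n) n \<noteq> 0" "degree (P n) = n" if "n \<in> I" for n
    using P that orthogonal_family_nonzero[OF u P that] leading_coeff_neq_0[of "P n"]
    by (auto simp: orthogonal_family_def)
  then show ?thesis
    using P
    by (auto simp: monic_orthogonal_family_def orthogonal_family_def functional_simps[OF u]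
        power2_eq_square)
qed

lemma monic_orthogonal_family_nth:
  assumes u: "functional u" and P: "monic_orthogonal_family {..<m} u P" and "n < m"
  shows "monic_orthogonal u n (P n)"
  using P \<open>n < m\<close> orthogonal_family_lower[OF u, of m P n]
  by (auto simp: monic_orthogonal_def monic_orthogonal_family_def orthogonal_family_def)

lemma three_term_recurrence:
  assumes u: "functional u" and P: "monic_orthogonal_family {..<m} u P" and n: "Suc n < m"
  shows "P (Suc n) = [:- ((if n = 0 then 0 else coeff (P n) (n - 1)) - coeff (P (Suc n)) n), 1:] * P n
    - (if n = 0 then 0 else smult (u (P n ^ 2) / u (P (n - 1) ^ 2)) (P (n - 1)))"
    (is "_ = _ * P n - ?M")
proof -
  define b where "b = (if n = 0 then 0 else coeff (P n) (n - 1)) - coeff (P (Suc n)) n"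
  define T where "T = P (Suc n) - ([:- b, 1:] * P n - ?M)"
  have fam: "orthogonal_family {..<m} u P"
    using P by (simp add: monic_orthogonal_family_def)
  have mo: "monic_orthogonal u k (P k)" if "k \<le> Suc n" for k
    using monic_orthogonal_family_nth[OF u P, of k] n that by simp
  have deg: "degree (P k) = k" "coeff (P k) k = 1" if "k \<le> Suc n" for k
    using mo[OF that] by (auto simp: monic_orthogonal_def)
  have coeff_above: "coeff (P k) j = 0" if "k \<le> Suc n" "k < j" for j k
    using deg[of k] that by (simp add: coeff_eq_0)
  have T: "coeff T j = 0" if "j \<ge> n" for j
  proof -
    have "j = n \<or> j = Suc n \<or> j > Suc n" using that by linarith
    then show ?thesis
      using deg[of n] deg[of "Suc n"] coeff_above
      by (elim disjE; cases n) (auto simp: T_def b_def coeff_pCons split: nat.split)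
  qed
  have "T = 0"
  proof (cases n)
    case 0
    then show ?thesis using T by (intro poly_eqI) simp
  next
    case (Suc k)
    have "degree T \<le> k"
      by (rule degree_le) (use T Suc in auto)
    have "u (T * q) = 0" if q: "degree q \<le> k" for q
    proof -
      have dq: "degree ([:0, 1:] * q) \<le> n"
        using degree_mult_le[of "[:0, 1::complex:]" q] q Suc by simp
      have nz: "u (P k ^ 2) \<noteq> 0"
        using fam n Suc by (auto simp: orthogonal_family_def)
      have "u (P (Suc n) * q) = 0" "u (P n * q) = 0"
        using mo[of "Suc n"] mo[of n] q Suc by (auto simp: monic_orthogonal_def)
      moreover have "u (P n * ([:0, 1:] * q)) = coeff q k * u (P n ^ 2)"
        using monic_orthogonal_norm[OF u mo[of n] dq] Suc by simp
      moreover have "u (P k * q) = coeff q k * u (P k ^ 2)"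
        using monic_orthogonal_norm[OF u mo[of k], of q] q Suc by simp
      moreover have "T * q = P (Suc n) * q - (P n * ([:0, 1:] * q) - smult b (P n * q))
          + smult (u (P n ^ 2) / u (P k ^ 2)) (P k * q)"
        by (simp add: T_def Suc algebra_simps)
      ultimately show ?thesis
        using nz by (simp only: functional_simps[OF u]) simp
    qed
    then show ?thesis
      using orthogonal_family_definite[OF u fam, of T] \<open>degree T \<le> k\<close> n Suc by auto
  qed
  then show ?thesis
    by (simp add: T_def b_def)
qed


lemma poly_eqI_infinite:
  assumes "infinite (X ` U)" and "\<And>s. s \<in> U \<Longrightarrow> poly p (X s) = poly q (X s)"
  shows "p = (q :: complex poly)"
proof (rule ccontr)
  assume "p \<noteq> q"
  then have "finite {x. poly (p - q) x = 0}"
    by (intro poly_roots_finite) simp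
  moreover have "X ` U \<subseteq> {x. poly (p - q) x = 0}"
    using assms by auto
  ultimately show False
    using assms(1) finite_subset by blast
qed

section \<open>Divided differences and averages on a centred lattice\<close>

locale centred_lattice =
  fixes h :: complex and U :: "complex set" and X :: "complex \<Rightarrow> complex" and \<kappa> \<Pi> :: complex
    and D S :: "complex poly \<Rightarrow> complex poly"
  assumes half_step: "s \<in> U \<Longrightarrow> s + h / 2 \<in> U" "s \<in> U \<Longrightarrow> s - h / 2 \<in> U"
    and infinite_range: "infinite (X ` U)"
    and step_nonzero: "s \<in> U \<Longrightarrow> X (s + h / 2) \<noteq> X (s - h / 2)"
    and step_sum: "s \<in> U \<Longrightarrow> X (s + h / 2) + X (s - h / 2) = 2 * \<kappa> * X s"
    and step_square: "s \<in> U \<Longrightarrow>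
      (X (s + h / 2) - X (s - h / 2))\<^sup>2 = 4 * (\<kappa>\<^sup>2 - 1) * ((X s)\<^sup>2 - 4 * \<Pi>)"
    and D_at: "s \<in> U \<Longrightarrow> poly (D p) (X s) * (X (s + h / 2) - X (s - h / 2))
      = poly p (X (s + h / 2)) - poly p (X (s - h / 2))"
    and S_at: "s \<in> U \<Longrightarrow> 2 * poly (S p) (X s) = poly p (X (s + h / 2)) + poly p (X (s - h / 2))"
begin

definition U1 :: "complex poly" where "U1 = [:0, \<kappa>\<^sup>2 - 1:]"
definition U2 :: "complex poly" where "U2 = smult (\<kappa>\<^sup>2 - 1) [:- 4 * \<Pi>, 0, 1:]"

lemma poly_eqI_at:
  assumes "\<And>s. s \<in> U \<Longrightarrow> poly p (X s) = poly q (X s)"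
  shows "p = q"
  using poly_eqI_infinite[OF infinite_range assms] .

lemma poly_eqI_at_step:
  assumes "\<And>s. s \<in> U \<Longrightarrow> poly p (X s) * (X (s + h / 2) - X (s - h / 2))
    = poly q (X s) * (X (s + h / 2) - X (s - h / 2))"
  shows "p = q"
  using assms step_nonzero by (intro poly_eqI_at) fastforce

lemma poly_eqI_at_2:
  assumes "\<And>s. s \<in> U \<Longrightarrow> 2 * poly p (X s) = 2 * poly q (X s)"
  shows "p = q"
  using assms by (intro poly_eqI_at) simp

lemma D_add: "D (p + q) = D p + D q"
  by (rule poly_eqI_at_step) (simp add: D_at distrib_right)

lemma S_add: "S (p + q) = S p + S q"
  by (rule poly_eqI_at_2) (simp add: S_at distrib_left)

lemma D_smult: "D (smult r p) = smult r (D p)"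
  by (rule poly_eqI_at_step) (simp only: D_at poly_smult mult.assoc, simp add: right_diff_distrib)

lemma S_smult: "S (smult r p) = smult r (S p)"
  by (rule poly_eqI_at_2) (simp add: S_at mult.left_commute[of 2] distrib_left)

lemma D_0 [simp]: "D 0 = 0" and S_0 [simp]: "S 0 = 0"
  using D_smult[of 0 0] S_smult[of 0 0] by simp_all

lemma D_sum: "D (sum f I) = (\<Sum>i\<in>I. D (f i))"
  by (induction I rule: infinite_finite_induct) (simp_all add: D_add)

lemma S_sum: "S (sum f I) = (\<Sum>i\<in>I. S (f i))"
  by (induction I rule: infinite_finite_induct) (simp_all add: S_add)

lemma D_const: "D [:r:] = 0"
  by (rule poly_eqI_at_step) (simp add: D_at)

lemma S_const: "S [:r:] = [:r:]"
  by (rule poly_eqI_at_2) (simp add: S_at)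

lemma D_1 [simp]: "D 1 = 0" and S_1 [simp]: "S 1 = 1"
  using D_const[of 1] S_const[of 1] by (simp_all add: pCons_one)

lemma D_pCons_0: "D (pCons 0 p) = S p + smult \<kappa> (pCons 0 (D p))"
proof (rule poly_eqI_at_step)
  fix s assume s: "s \<in> U"
  define x y z where "x = X s" and "y = X (s + h / 2)" and "z = X (s - h / 2)"
  have "2 * ((poly (S p) x + \<kappa> * (x * poly (D p) x)) * (y - z))
      = (2 * poly (S p) x) * (y - z) + (2 * \<kappa> * x) * (poly (D p) x * (y - z))"
    by (simp add: algebra_simps)
  also have "\<dots> = (poly p y + poly p z) * (y - z) + (y + z) * (poly p y - poly p z)"
    using D_at[OF s, of p] S_at[OF s, of p] step_sum[OF s] by (simp add: x_def y_def z_def)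
  also have "\<dots> = 2 * (y * poly p y - z * poly p z)"
    by (simp add: algebra_simps)
  also have "y * poly p y - z * poly p z = poly (D (pCons 0 p)) x * (y - z)"
    using D_at[OF s, of "pCons 0 p"] by (simp add: x_def y_def z_def)
  finally show "poly (D (pCons 0 p)) (X s) * (X (s + h / 2) - X (s - h / 2))
      = poly (S p + smult \<kappa> (pCons 0 (D p))) (X s) * (X (s + h / 2) - X (s - h / 2))"
    by (auto simp: x_def y_def z_def mult.left_commute)
qed

lemma S_pCons_0: "S (pCons 0 p) = smult \<kappa> (pCons 0 (S p)) + U2 * D p"
proof (rule poly_eqI_at_step)
  fix s assume s: "s \<in> U"
  define x y z where "x = X s" and "y = X (s + h / 2)" and "z = X (s - h / 2)"
  have sq: "4 * poly U2 x = (y - z)\<^sup>2"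
    using step_square[OF s] by (simp add: U2_def x_def y_def z_def power2_eq_square algebra_simps)
  have "4 * ((\<kappa> * (x * poly (S p) x) + poly U2 x * poly (D p) x) * (y - z))
      = ((2 * \<kappa> * x) * (2 * poly (S p) x)) * (y - z) + (4 * poly U2 x) * (poly (D p) x * (y - z))"
    by (simp add: algebra_simps)
  also have "\<dots> = ((y + z) * (poly p y + poly p z)) * (y - z) + (y - z)\<^sup>2 * (poly p y - poly p z)"
    using D_at[OF s, of p] S_at[OF s, of p] step_sum[OF s] sq by (simp add: x_def y_def z_def)
  also have "\<dots> = 2 * ((y * poly p y + z * poly p z) * (y - z))"
    by (simp add: algebra_simps power2_eq_square)
  also have "y * poly p y + z * poly p z = 2 * poly (S (pCons 0 p)) x"
    using S_at[OF s, of "pCons 0 p"] by (simp add: x_def y_def z_def)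
  also have "2 * (2 * poly (S (pCons 0 p)) x * (y - z)) = 4 * (poly (S (pCons 0 p)) x * (y - z))"
    by simp
  finally show "poly (S (pCons 0 p)) (X s) * (X (s + h / 2) - X (s - h / 2))
      = poly (smult \<kappa> (pCons 0 (S p)) + U2 * D p) (X s) * (X (s + h / 2) - X (s - h / 2))"
    by (auto simp: x_def y_def z_def mult.left_commute)
qed

lemma pCons_decompose: "pCons r p = [:r:] + pCons 0 p"
  by simp

lemma D_linear: "D [:r0, r1:] = [:r1:]"
  by (subst pCons_decompose) (simp only: D_add D_const D_pCons_0 S_const; simp)

lemma S_linear: "S [:r0, r1:] = [:r0, \<kappa> * r1:]"
  by (subst pCons_decompose) (simp only: S_add D_const S_pCons_0 S_const; simp)

lemma D_quadratic: "D [:r0, r1, r2:] = [:r1, 2 * \<kappa> * r2:]"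
  by (subst pCons_decompose) (simp only: D_add D_const D_pCons_0 D_linear S_linear; simp)

lemma S_quadratic: "S [:r0, r1, r2:] = [:r0 - 4 * \<Pi> * (\<kappa>\<^sup>2 - 1) * r2, \<kappa> * r1, (2 * \<kappa>\<^sup>2 - 1) * r2:]"
  by (subst pCons_decompose)
    (simp only: S_add S_const S_pCons_0 D_linear S_linear; simp add: U2_def algebra_simps power2_eq_square)

definition E :: "complex poly \<Rightarrow> complex poly \<Rightarrow> complex poly \<Rightarrow> complex poly" where
  "E \<phi> \<psi> p = \<phi> * D p + \<psi> * S p"

definition F :: "complex poly \<Rightarrow> complex poly \<Rightarrow> complex poly \<Rightarrow> complex poly" where
  "F \<phi> \<psi> p = \<phi> * S p + U2 * \<psi> * D p"

definition rise :: "complex poly \<Rightarrow> complex poly \<Rightarrow> complex \<Rightarrow> complex" where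
  "rise \<phi> \<psi> s = poly \<phi> (X s) + poly \<psi> (X s) * (X (s + h / 2) - X (s - h / 2)) / 2"

definition fall :: "complex poly \<Rightarrow> complex poly \<Rightarrow> complex \<Rightarrow> complex" where
  "fall \<phi> \<psi> s = poly \<phi> (X s) - poly \<psi> (X s) * (X (s + h / 2) - X (s - h / 2)) / 2"

lemma E_at:
  assumes s: "s \<in> U"
  shows "poly (E \<phi> \<psi> p) (X s) * (X (s + h / 2) - X (s - h / 2))
    = rise \<phi> \<psi> s * poly p (X (s + h / 2)) - fall \<phi> \<psi> s * poly p (X (s - h / 2))"
proof -
  define x y z where "x = X s" and "y = X (s + h / 2)" and "z = X (s - h / 2)"
  have "2 * (poly (E \<phi> \<psi> p) x * (y - z))
      = 2 * poly \<phi> x * (poly (D p) x * (y - z)) + poly \<psi> x * (2 * poly (S p) x) * (y - z)"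
    by (simp add: E_def algebra_simps)
  also have "\<dots> = 2 * poly \<phi> x * (poly p y - poly p z) + poly \<psi> x * (poly p y + poly p z) * (y - z)"
    using D_at[OF s, of p] S_at[OF s, of p] by (simp add: x_def y_def z_def)
  also have "\<dots> = 2 * (rise \<phi> \<psi> s * poly p y - fall \<phi> \<psi> s * poly p z)"
    unfolding rise_def fall_def x_def[symmetric] y_def[symmetric] z_def[symmetric]
    by (simp add: field_simps)
  finally show ?thesis
    unfolding mult_cancel_left by (simp add: x_def y_def z_def)
qed

lemma F_at:
  assumes s: "s \<in> U"
  shows "2 * poly (F \<phi> \<psi> p) (X s)
    = rise \<phi> \<psi> s * poly p (X (s + h / 2)) + fall \<phi> \<psi> s * poly p (X (s - h / 2))"
proof -
  define x y z where "x = X s" and "y = X (s + h / 2)" and "z = X (s - h / 2)"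
  have sq: "4 * poly U2 x = (y - z)\<^sup>2"
    using step_square[OF s] by (simp add: U2_def x_def y_def z_def power2_eq_square algebra_simps)
  have "2 * (2 * poly (F \<phi> \<psi> p) x)
      = 2 * poly \<phi> x * (2 * poly (S p) x) + (4 * poly U2 x) * (poly \<psi> x * poly (D p) x)"
    by (simp add: F_def algebra_simps)
  also have "\<dots> = 2 * poly \<phi> x * (2 * poly (S p) x) + poly \<psi> x * (y - z) * (poly (D p) x * (y - z))"
    by (simp only: sq) (simp add: power2_eq_square algebra_simps)
  also have "\<dots> = 2 * poly \<phi> x * (poly p y + poly p z) + poly \<psi> x * (y - z) * (poly p y - poly p z)"
    using D_at[OF s, of p] S_at[OF s, of p] by (simp add: x_def y_def z_def)
  also have "\<dots> = 2 * (rise \<phi> \<psi> s * poly p y + fall \<phi> \<psi> s * poly p z)"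
    unfolding rise_def fall_def x_def[symmetric] y_def[symmetric] z_def[symmetric]
    by (simp add: field_simps)
  finally show ?thesis
    unfolding mult_cancel_left by (simp add: x_def y_def z_def)
qed

definition lift :: "complex poly \<Rightarrow> complex poly \<Rightarrow> complex poly \<Rightarrow> complex poly" where
  "lift \<phi> \<psi> p = smult \<kappa> (F \<phi> \<psi> p) - U1 * E \<phi> \<psi> p"

text \<open>
  The combination \<open>lift\<close> is chosen because \<open>\<kappa> (X(s + h) - X(s)) - 2 (\<kappa>\<^sup>2 - 1) X(s + h/2)\<close>
  equals \<open>X(s + h/2) - X(s - h/2)\<close>.
\<close>

lemma lift_at:
  assumes s: "s \<in> U"
  shows "2 * poly (lift \<phi> \<psi> p) (X (s + h / 2))
      = poly (E \<phi> \<psi> p) (X (s + h / 2)) * (X (s + h / 2) - X (s - h / 2))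
        + 2 * \<kappa> * fall \<phi> \<psi> (s + h / 2) * poly p (X s)" (is ?up)
    and "2 * poly (lift \<phi> \<psi> p) (X (s - h / 2))
      = - poly (E \<phi> \<psi> p) (X (s - h / 2)) * (X (s + h / 2) - X (s - h / 2))
        + 2 * \<kappa> * rise \<phi> \<psi> (s - h / 2) * poly p (X s)" (is ?down)
proof -
  define x y z where "x = X s" and "y = X (s + h / 2)" and "z = X (s - h / 2)"
  define y1 z1 where "y1 = X (s + h / 2 + h / 2)" and "z1 = X (s - h / 2 - h / 2)"
  have yz: "z = 2 * \<kappa> * x - y"
    using step_sum[OF s] by (simp add: x_def y_def z_def algebra_simps)
  have y1: "y1 = 2 * \<kappa> * y - x" and z1: "z1 = 2 * \<kappa> * z - x"
    using step_sum[OF half_step(1)[OF s]] step_sum[OF half_step(2)[OF s]]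
    by (simp_all add: x_def y_def z_def y1_def z1_def algebra_simps)
  have E1: "poly (E \<phi> \<psi> p) y * (y1 - x)
      = rise \<phi> \<psi> (s + h / 2) * poly p y1 - fall \<phi> \<psi> (s + h / 2) * poly p x"
    and F1: "2 * poly (F \<phi> \<psi> p) y
      = rise \<phi> \<psi> (s + h / 2) * poly p y1 + fall \<phi> \<psi> (s + h / 2) * poly p x"
    using E_at[OF half_step(1)[OF s]] F_at[OF half_step(1)[OF s]]
    by (simp_all add: x_def y_def y1_def)
  have E2: "poly (E \<phi> \<psi> p) z * (x - z1)
      = rise \<phi> \<psi> (s - h / 2) * poly p x - fall \<phi> \<psi> (s - h / 2) * poly p z1"
    and F2: "2 * poly (F \<phi> \<psi> p) z
      = rise \<phi> \<psi> (s - h / 2) * poly p x + fall \<phi> \<psi> (s - h / 2) * poly p z1"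
    using E_at[OF half_step(2)[OF s]] F_at[OF half_step(2)[OF s]]
    by (simp_all add: x_def z_def z1_def)
  have "2 * poly (lift \<phi> \<psi> p) y = \<kappa> * (2 * poly (F \<phi> \<psi> p) y) - 2 * (\<kappa>\<^sup>2 - 1) * y * poly (E \<phi> \<psi> p) y"
    by (simp add: lift_def U1_def algebra_simps)
  also have "2 * poly (F \<phi> \<psi> p) y
      = poly (E \<phi> \<psi> p) y * (y1 - x) + 2 * fall \<phi> \<psi> (s + h / 2) * poly p x"
    by (simp add: E1 F1)
  finally have "2 * poly (lift \<phi> \<psi> p) y
      = poly (E \<phi> \<psi> p) y * (y - z) + 2 * \<kappa> * fall \<phi> \<psi> (s + h / 2) * poly p x"
    by (simp add: y1 yz algebra_simps power2_eq_square)
  then show ?up by (simp add: x_def y_def z_def)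
  have "2 * poly (lift \<phi> \<psi> p) z = \<kappa> * (2 * poly (F \<phi> \<psi> p) z) - 2 * (\<kappa>\<^sup>2 - 1) * z * poly (E \<phi> \<psi> p) z"
    by (simp add: lift_def U1_def algebra_simps)
  also have "2 * poly (F \<phi> \<psi> p) z
      = - poly (E \<phi> \<psi> p) z * (x - z1) + 2 * rise \<phi> \<psi> (s - h / 2) * poly p x"
    using E2 F2 by (simp add: algebra_simps)
  finally have "2 * poly (lift \<phi> \<psi> p) z
      = - poly (E \<phi> \<psi> p) z * ((2 * \<kappa> * x - z) - z) + 2 * \<kappa> * rise \<phi> \<psi> (s - h / 2) * poly p x"
    by (simp add: z1 algebra_simps power2_eq_square)
  then show ?down by (simp add: x_def y_def z_def step_sum[OF s, symmetric])
qed

lemma F_E_eq: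
  assumes R: "\<And>s. s \<in> U \<Longrightarrow> poly R (X s) * (X (s + h / 2) - X (s - h / 2))
    = rise \<phi> \<psi> s * fall \<phi>' \<psi>' (s + h / 2) - fall \<phi> \<psi> s * rise \<phi>' \<psi>' (s - h / 2)"
  shows "F \<phi> \<psi> (E \<phi>' \<psi>' p) = E \<phi> \<psi> (lift \<phi>' \<psi>' p) - smult \<kappa> (R * p)"
proof (rule poly_eqI_at_step)
  fix s assume s: "s \<in> U"
  define x y z where "x = X s" and "y = X (s + h / 2)" and "z = X (s - h / 2)"
  define A B where "A = rise \<phi> \<psi> s" and "B = fall \<phi> \<psi> s"
  define a b where "a = fall \<phi>' \<psi>' (s + h / 2)" and "b = rise \<phi>' \<psi>' (s - h / 2)"
  let ?W = "poly (E \<phi>' \<psi>' p)" and ?P = "poly (lift \<phi>' \<psi>' p)"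
  have P: "2 * ?P y = ?W y * (y - z) + 2 * \<kappa> * a * poly p x"
    "2 * ?P z = - ?W z * (y - z) + 2 * \<kappa> * b * poly p x"
    using lift_at[OF s, of \<phi>' \<psi>' p] by (simp_all add: x_def y_def z_def a_def b_def)
  have EP: "poly (E \<phi> \<psi> (lift \<phi>' \<psi>' p)) x * (y - z) = A * ?P y - B * ?P z"
    and RR: "poly R x * (y - z) = A * a - B * b"
    using E_at[OF s, of \<phi> \<psi> "lift \<phi>' \<psi>' p"] R[OF s]
    by (simp_all add: x_def y_def z_def A_def B_def a_def b_def)
  have "2 * (poly (E \<phi> \<psi> (lift \<phi>' \<psi>' p) - smult \<kappa> (R * p)) x * (y - z))
      = 2 * (poly (E \<phi> \<psi> (lift \<phi>' \<psi>' p)) x * (y - z)) - 2 * \<kappa> * (poly R x * (y - z)) * poly p x"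
    by (simp add: algebra_simps)
  also have "\<dots> = A * (2 * ?P y) - B * (2 * ?P z) - 2 * \<kappa> * (A * a - B * b) * poly p x"
    unfolding EP RR by (simp add: algebra_simps)
  also have "\<dots> = (A * ?W y + B * ?W z) * (y - z)"
    unfolding P by (simp add: algebra_simps)
  also have "\<dots> = 2 * (poly (F \<phi> \<psi> (E \<phi>' \<psi>' p)) x * (y - z))"
    using F_at[OF s, of \<phi> \<psi> "E \<phi>' \<psi>' p"] by (simp add: x_def y_def z_def A_def B_def)
  finally show "poly (F \<phi> \<psi> (E \<phi>' \<psi>' p)) (X s) * (X (s + h / 2) - X (s - h / 2))
     = poly (E \<phi> \<psi> (lift \<phi>' \<psi>' p) - smult \<kappa> (R * p)) (X s) * (X (s + h / 2) - X (s - h / 2))"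
    by (auto simp add: x_def y_def z_def)
qed

lemma F_mult_D: "F \<phi> \<psi> (g * D p) = E \<phi> \<psi> (lift g 0 p) - smult \<kappa> (E \<phi> \<psi> g * p)"
proof -
  have "F \<phi> \<psi> (E g 0 p) = E \<phi> \<psi> (lift g 0 p) - smult \<kappa> (E \<phi> \<psi> g * p)"
    by (rule F_E_eq) (simp add: E_at, simp add: rise_def fall_def)
  then show ?thesis by (simp add: E_def)
qed

definition next_\<phi> :: "complex poly \<Rightarrow> complex poly \<Rightarrow> complex poly" where
  "next_\<phi> \<phi> \<psi> = S \<phi> + U1 * S \<psi> + smult \<kappa> (U2 * D \<psi>)"

definition next_\<psi> :: "complex poly \<Rightarrow> complex poly \<Rightarrow> complex poly" where
  "next_\<psi> \<phi> \<psi> = D \<phi> + smult \<kappa> (S \<psi>) + U1 * D \<psi>"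

lemma next_at:
  assumes s: "s \<in> U"
  shows "rise (next_\<phi> \<phi> \<psi>) (next_\<psi> \<phi> \<psi>) s = rise \<phi> \<psi> (s + h / 2)"
    and "fall (next_\<phi> \<phi> \<psi>) (next_\<psi> \<phi> \<psi>) s = fall \<phi> \<psi> (s - h / 2)"
proof -
  define x y z where "x = X s" and "y = X (s + h / 2)" and "z = X (s - h / 2)"
  have yz: "z = 2 * \<kappa> * x - y"
    using step_sum[OF s] by (simp add: x_def y_def z_def algebra_simps)
  have y1: "X (s + h / 2 + h / 2) = 2 * \<kappa> * y - x" and z1: "X (s - h / 2 - h / 2) = 2 * \<kappa> * z - x"
    using step_sum[OF half_step(1)[OF s]] step_sum[OF half_step(2)[OF s]]
    by (simp_all add: x_def y_def z_def algebra_simps)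
  have rise: "rise \<phi> \<psi> (s + h / 2) = poly \<phi> y + poly \<psi> y * (\<kappa> * y - x)"
    and fall: "fall \<phi> \<psi> (s - h / 2) = poly \<phi> z - poly \<psi> z * (x - \<kappa> * z)"
    unfolding rise_def fall_def y1 z1 by (simp_all add: x_def y_def z_def field_simps)
  have sq: "4 * poly U2 x = (y - z)\<^sup>2"
    using step_square[OF s] by (simp add: U2_def x_def y_def z_def power2_eq_square algebra_simps)
  have S: "2 * poly (S p) x = poly p y + poly p z"
    and D: "poly (D p) x * (y - z) = poly p y - poly p z" for p
    using S_at[OF s, of p] D_at[OF s, of p] by (simp_all add: x_def y_def z_def)
  have "2 * poly (next_\<phi> \<phi> \<psi>) x
      = 2 * poly (S \<phi>) x + (\<kappa>\<^sup>2 - 1) * x * (2 * poly (S \<psi>) x) + \<kappa> / 2 * (4 * poly U2 x * poly (D \<psi>) x)"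
    by (simp add: next_\<phi>_def U1_def algebra_simps)
  also have "4 * poly U2 x * poly (D \<psi>) x = (y - z) * (poly \<psi> y - poly \<psi> z)"
    unfolding sq D[symmetric] by (simp add: power2_eq_square)
  finally have \<phi>': "2 * poly (next_\<phi> \<phi> \<psi>) x = (poly \<phi> y + poly \<phi> z)
      + (\<kappa>\<^sup>2 - 1) * x * (poly \<psi> y + poly \<psi> z) + \<kappa> / 2 * ((y - z) * (poly \<psi> y - poly \<psi> z))"
    by (simp add: S)
  have "2 * (poly (next_\<psi> \<phi> \<psi>) x * (y - z))
      = 2 * (poly (D \<phi>) x * (y - z)) + \<kappa> * (2 * poly (S \<psi>) x) * (y - z)
        + 2 * (\<kappa>\<^sup>2 - 1) * x * (poly (D \<psi>) x * (y - z))"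
    by (simp add: next_\<psi>_def U1_def algebra_simps)
  also note D also note S also note D
  finally have \<psi>': "2 * (poly (next_\<psi> \<phi> \<psi>) x * (y - z)) = 2 * (poly \<phi> y - poly \<phi> z)
      + \<kappa> * (poly \<psi> y + poly \<psi> z) * (y - z) + 2 * (\<kappa>\<^sup>2 - 1) * x * (poly \<psi> y - poly \<psi> z)" .
  have "4 * rise (next_\<phi> \<phi> \<psi>) (next_\<psi> \<phi> \<psi>) s
      = 2 * (2 * poly (next_\<phi> \<phi> \<psi>) x) + 2 * (poly (next_\<psi> \<phi> \<psi>) x * (y - z))"
    by (simp add: rise_def x_def y_def z_def)
  also have "\<dots> = 4 * rise \<phi> \<psi> (s + h / 2)"
    unfolding \<phi>' \<psi>' rise by (simp add: yz field_simps power2_eq_square)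
  finally show "rise (next_\<phi> \<phi> \<psi>) (next_\<psi> \<phi> \<psi>) s = rise \<phi> \<psi> (s + h / 2)" by simp
  have "4 * fall (next_\<phi> \<phi> \<psi>) (next_\<psi> \<phi> \<psi>) s
      = 2 * (2 * poly (next_\<phi> \<phi> \<psi>) x) - 2 * (poly (next_\<psi> \<phi> \<psi>) x * (y - z))"
    by (simp add: fall_def x_def y_def z_def)
  also have "\<dots> = 4 * fall \<phi> \<psi> (s - h / 2)"
    unfolding \<phi>' \<psi>' fall by (simp add: yz field_simps power2_eq_square)
  finally show "fall (next_\<phi> \<phi> \<psi>) (next_\<psi> \<phi> \<psi>) s = fall \<phi> \<psi> (s - h / 2)" by simp
qed

lemma F_E_next:
  "F \<phi> \<psi> (E (next_\<phi> \<phi> \<psi>) (next_\<psi> \<phi> \<psi>) p) = E \<phi> \<psi> (lift (next_\<phi> \<phi> \<psi>) (next_\<psi> \<phi> \<psi>) p)"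
  using F_E_eq[of 0 \<phi> \<psi> "next_\<phi> \<phi> \<psi>" "next_\<psi> \<phi> \<psi>" p] next_at[of _ \<phi> \<psi>] half_step
  by (simp add: mult.commute)

end

section \<open>Pearson equations and the ladder of functionals\<close>

locale pearson_ladder = centred_lattice +
  fixes \<alpha> \<gamma> d e :: "nat \<Rightarrow> complex" and \<phi>0 \<phi>1 \<phi>2 \<psi>0 \<psi>1 :: complex
    and u :: "complex poly \<Rightarrow> complex"
  assumes \<alpha>_0: "\<alpha> 0 = 1" and \<alpha>_Suc: "\<alpha> (Suc n) = \<kappa> * \<alpha> n + (\<kappa>\<^sup>2 - 1) * \<gamma> n"
    and \<gamma>_0: "\<gamma> 0 = 0" and \<gamma>_Suc: "\<gamma> (Suc n) = \<alpha> n + \<kappa> * \<gamma> n"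
    and d: "d n = \<phi>2 * \<gamma> n + \<psi>1 * \<alpha> n"
    and e: "e n = \<phi>1 * \<gamma> n + \<psi>0 * \<alpha> n"
    and functional_u: "functional u"
    and pearson_u: "u (E [:\<phi>0, \<phi>1, \<phi>2:] [:\<psi>0, \<psi>1:] p) = 0"
begin

lemma U2_mult: "U2 * p = smult (\<kappa>\<^sup>2 - 1) (pCons 0 (pCons 0 p) - smult (4 * \<Pi>) p)"
  by (simp add: U2_def smult_diff_right smult_add_right)

lemma coeff_D_S_monom:
  "(\<forall>n. k \<le> n + 2 \<longrightarrow> coeff (D (monom 1 k)) n = (if k = Suc n then \<gamma> k else 0)) \<and>
   (\<forall>n. k \<le> n + 1 \<longrightarrow> coeff (S (monom 1 k)) n = (if k = n then \<alpha> k else 0))"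
proof (induction k)
  case 0
  then show ?case by (auto simp: \<alpha>_0)
next
  case (Suc k)
  have D: "coeff (D (monom 1 k)) n = (if k = Suc n then \<gamma> k else 0)" if "k \<le> n + 2" for n
    using Suc that by blast
  have S: "coeff (S (monom 1 k)) n = (if k = n then \<alpha> k else 0)" if "k \<le> n + 1" for n
    using Suc that by blast
  have "coeff (D (monom 1 (Suc k))) n = (if Suc k = Suc n then \<gamma> (Suc k) else 0)"
    if "Suc k \<le> n + 2" for n
  proof (cases n)
    case 0
    then show ?thesis
      using that by (simp add: monom_Suc D_pCons_0 S \<gamma>_Suc \<gamma>_0)
  next
    case (Suc j)
    then show ?thesis
      using that by (simp add: monom_Suc D_pCons_0 D S \<gamma>_Suc)
  qed
  moreover have "coeff (S (monom 1 (Suc k))) n = (if Suc k = n then \<alpha> (Suc k) else 0)"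
    if "Suc k \<le> n + 1" for n
  proof -
    consider "n = 0" | "n = 1" | j where "n = Suc (Suc j)"
      by (metis One_nat_def not0_implies_Suc)
    then show ?thesis
    proof cases
      case 1
      then show ?thesis
        using that by (simp add: monom_Suc S_pCons_0 U2_mult D)
    next
      case 2
      then show ?thesis
        using that by (auto simp: monom_Suc S_pCons_0 U2_mult D S \<alpha>_Suc \<gamma>_0 coeff_pCons)
    next
      case 3
      then show ?thesis
        using that by (simp add: monom_Suc S_pCons_0 U2_mult D S \<alpha>_Suc)
    qed
  qed
  ultimately show ?case by blast
qed

lemma coeff_D:
  assumes "degree p \<le> n + 2"
  shows "coeff (D p) n = \<gamma> (Suc n) * coeff p (Suc n)"
proof -
  have "p = (\<Sum>i\<le>n + 2. smult (coeff p i) (monom 1 i))"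
    using poly_as_sum_of_monoms'[OF assms] by (simp add: smult_monom)
  then have "D p = D (\<Sum>i\<le>n + 2. smult (coeff p i) (monom 1 i))"
    by (rule arg_cong)
  then have "coeff (D p) n = (\<Sum>i\<le>n + 2. coeff p i * coeff (D (monom 1 i)) n)"
    by (simp only: D_sum D_smult coeff_sum coeff_smult)
  also have "\<dots> = (\<Sum>i\<le>n + 2. if i = Suc n then \<gamma> i * coeff p i else 0)"
    using coeff_D_S_monom by (intro sum.cong) auto
  also have "\<dots> = \<gamma> (Suc n) * coeff p (Suc n)"
    by (subst sum.delta) auto
  finally show ?thesis .
qed

lemma coeff_S:
  assumes "degree p \<le> n + 1"
  shows "coeff (S p) n = \<alpha> n * coeff p n"
proof -
  have "p = (\<Sum>i\<le>n + 1. smult (coeff p i) (monom 1 i))"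
    using poly_as_sum_of_monoms'[OF assms] by (simp add: smult_monom)
  then have "S p = S (\<Sum>i\<le>n + 1. smult (coeff p i) (monom 1 i))"
    by (rule arg_cong)
  then have "coeff (S p) n = (\<Sum>i\<le>n + 1. coeff p i * coeff (S (monom 1 i)) n)"
    by (simp only: S_sum S_smult coeff_sum coeff_smult)
  also have "\<dots> = (\<Sum>i\<le>n + 1. if i = n then \<alpha> i * coeff p i else 0)"
    using coeff_D_S_monom by (intro sum.cong) auto
  also have "\<dots> = \<alpha> n * coeff p n"
    by (subst sum.delta) auto
  finally show ?thesis .
qed

lemma addition:
  "\<alpha> (m + n) = \<alpha> m * \<alpha> n + (\<kappa>\<^sup>2 - 1) * \<gamma> m * \<gamma> n"
  "\<gamma> (m + n) = \<alpha> m * \<gamma> n + \<gamma> m * \<alpha> n"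
proof (induction m)
  case (Suc m)
  {
    case 1
    then show ?case
      by (simp only: add_Suc \<alpha>_Suc \<gamma>_Suc Suc.IH) (simp add: algebra_simps power2_eq_square)
  next
    case 2
    then show ?case
      by (simp only: add_Suc \<alpha>_Suc \<gamma>_Suc Suc.IH) (simp add: algebra_simps power2_eq_square)
  }
qed (simp_all add: \<alpha>_0 \<gamma>_0)

definition top_coeff :: "nat \<Rightarrow> complex" where
  "top_coeff n = \<psi>1 * (\<kappa>\<^sup>2 - 1) * \<gamma> (2 * n) + \<phi>2 * \<alpha> (2 * n)"

definition \<Phi> :: "nat \<Rightarrow> complex poly" where
  "\<Phi> n = [:\<phi>0 + 2 * \<phi>2 * \<Pi> - 2 * \<Pi> * top_coeff n, \<phi>1 * \<alpha> n + \<psi>0 * (\<kappa>\<^sup>2 - 1) * \<gamma> n, top_coeff n:]"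

definition \<Psi> :: "nat \<Rightarrow> complex poly" where
  "\<Psi> n = [:e n, d (2 * n):]"

lemma \<Phi>_0: "\<Phi> 0 = [:\<phi>0, \<phi>1, \<phi>2:]" and \<Psi>_0: "\<Psi> 0 = [:\<psi>0, \<psi>1:]"
  by (simp_all add: \<Phi>_def \<Psi>_def top_coeff_def d e \<alpha>_0 \<gamma>_0)

lemma top_coeff_Suc: "top_coeff (Suc n) = (2 * \<kappa>\<^sup>2 - 1) * top_coeff n + 2 * \<kappa> * (\<kappa>\<^sup>2 - 1) * d (2 * n)"
  by (simp add: top_coeff_def d \<alpha>_Suc \<gamma>_Suc algebra_simps power2_eq_square)

lemma next_\<Phi>: "next_\<phi> (\<Phi> n) (\<Psi> n) = \<Phi> (Suc n)"
  by (simp add: next_\<phi>_def \<Phi>_def \<Psi>_def S_quadratic S_linear D_linear U1_def U2_def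
      top_coeff_Suc e \<alpha>_Suc \<gamma>_Suc algebra_simps power2_eq_square)

lemma next_\<Psi>: "next_\<psi> (\<Phi> n) (\<Psi> n) = \<Psi> (Suc n)"
  by (simp add: next_\<psi>_def \<Phi>_def \<Psi>_def D_quadratic S_linear D_linear U1_def
      top_coeff_def d e \<alpha>_Suc \<gamma>_Suc algebra_simps power2_eq_square)

primrec ladder :: "nat \<Rightarrow> complex poly \<Rightarrow> complex" where
  "ladder 0 = u"
| "ladder (Suc n) = (\<lambda>p. ladder n (F (\<Phi> n) (\<Psi> n) p))"

lemma functional_ladder: "functional (ladder n)"
proof (induction n)
  case (Suc n)
  have "F (\<Phi> n) (\<Psi> n) (p + q) = F (\<Phi> n) (\<Psi> n) p + F (\<Phi> n) (\<Psi> n) q"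
    and "F (\<Phi> n) (\<Psi> n) (smult r p) = smult r (F (\<Phi> n) (\<Psi> n) p)" for p q r
    by (simp_all add: F_def S_add D_add S_smult D_smult distrib_left smult_add_right)
  then show ?case
    by (intro functionalI) (simp_all add: functional_simps[OF Suc])
qed (simp add: functional_u)

lemma pearson_ladder: "ladder n (E (\<Phi> n) (\<Psi> n) p) = 0"
proof (induction n arbitrary: p)
  case 0
  then show ?case by (simp add: \<Phi>_0 \<Psi>_0 pearson_u)
next
  case (Suc n)
  then show ?case
    using F_E_next[of "\<Phi> n" "\<Psi> n" p] by (simp add: next_\<Phi> next_\<Psi>)
qed

lemma ladder_mult_D: "ladder (Suc n) (g * D p) = - \<kappa> * ladder n (p * E (\<Phi> n) (\<Psi> n) g)"
  by (simp add: F_mult_D functional_simps[OF functional_ladder] pearson_ladder mult.commute)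

lemma coeff_quadratic_mult:
  "coeff ([:r0, r1, r2:] * p) (Suc k)
    = r0 * coeff p (Suc k) + r1 * coeff p k + (if k = 0 then 0 else r2 * coeff p (k - 1))"
  for p :: "complex poly"
  by (cases k) simp_all

lemma coeff_E:
  assumes "degree g \<le> k"
  shows "coeff (E (\<Phi> n) (\<Psi> n) g) (Suc k) = d (2 * n + k) * coeff g k"
proof -
  have D: "coeff (D g) (Suc k) = 0" "coeff (D g) k = 0"
    "k \<noteq> 0 \<Longrightarrow> coeff (D g) (k - 1) = \<gamma> k * coeff g k"
    using assms coeff_D[of g "Suc k"] coeff_D[of g k] coeff_D[of g "k - 1"]
    by (auto simp: coeff_eq_0)
  have S: "coeff (S g) (Suc k) = 0" "coeff (S g) k = \<alpha> k * coeff g k"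
    using assms coeff_S[of g "Suc k"] coeff_S[of g k] by (auto simp: coeff_eq_0)
  have "coeff (\<Phi> n * D g) (Suc k) = top_coeff n * \<gamma> k * coeff g k"
    unfolding \<Phi>_def coeff_quadratic_mult using D \<gamma>_0 by simp
  moreover have "coeff (\<Psi> n * S g) (Suc k) = d (2 * n) * \<alpha> k * coeff g k"
    unfolding \<Psi>_def using S by simp
  moreover have "d (2 * n + k) = top_coeff n * \<gamma> k + d (2 * n) * \<alpha> k"
    by (simp add: d top_coeff_def addition algebra_simps)
  ultimately show ?thesis
    by (simp add: E_def algebra_simps)
qed

lemma degree_E: "degree (E (\<Phi> n) (\<Psi> n) g) \<le> Suc (degree g)"
proof (rule degree_le, intro allI impI)
  fix i assume "Suc (degree g) < i"
  then show "coeff (E (\<Phi> n) (\<Psi> n) g) i = 0"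
    using coeff_E[of g "i - 1" n] by (simp add: coeff_eq_0)
qed

lemma descend:
  assumes P: "monic_orthogonal (ladder n) (Suc k) P" and \<gamma>: "\<gamma> (Suc k) \<noteq> 0"
  defines "Q \<equiv> smult (inverse (\<gamma> (Suc k))) (D P)"
  shows "monic_orthogonal (ladder (Suc n)) k Q"
    and "- \<kappa> * d (2 * n + k) * ladder n (P ^ 2) = \<gamma> (Suc k) * ladder (Suc n) (Q ^ 2)"
proof -
  have degP: "degree P = Suc k" "coeff P (Suc k) = 1"
    using P by (auto simp: monic_orthogonal_def)
  have "coeff Q k = 1"
    using coeff_D[of P k] degP \<gamma> by (simp add: Q_def)
  moreover have "degree Q \<le> k"
    using coeff_D[of P] degP by (intro degree_le) (auto simp: Q_def coeff_eq_0)
  ultimately have degQ: "degree Q = k" "coeff Q k = 1"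
    using le_degree[of Q k] by auto
  have DP: "D P = smult (\<gamma> (Suc k)) Q"
    using \<gamma> by (simp add: Q_def)
  have "ladder (Suc n) (Q * q) = 0" if "degree q < k" for q
  proof -
    have "degree (E (\<Phi> n) (\<Psi> n) q) < Suc k"
      using degree_E[of n q] that by simp
    then have "ladder (Suc n) (q * D P) = 0"
      using P by (simp only: ladder_mult_D) (simp add: monic_orthogonal_def)
    then show ?thesis
      using \<gamma> by (simp only: DP mult_smult_right functional_simps[OF functional_ladder] mult.commute[of Q]) simp
  qed
  then show "monic_orthogonal (ladder (Suc n)) k Q"
    using degQ by (simp add: monic_orthogonal_def del: ladder.simps)
  have "ladder n (P * E (\<Phi> n) (\<Psi> n) Q) = d (2 * n + k) * ladder n (P ^ 2)"
    using monic_orthogonal_norm[OF functional_ladder P, of "E (\<Phi> n) (\<Psi> n) Q"]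
      degree_E[of n Q] coeff_E[of Q k n] degQ by simp
  moreover have "ladder (Suc n) (Q * D P) = \<gamma> (Suc k) * ladder (Suc n) (Q ^ 2)"
    by (simp only: DP mult_smult_right functional_simps[OF functional_ladder] power2_eq_square)
  ultimately show "- \<kappa> * d (2 * n + k) * ladder n (P ^ 2) = \<gamma> (Suc k) * ladder (Suc n) (Q ^ 2)"
    using ladder_mult_D[of n Q P] by (simp only: mult.assoc)
qed

lemma ladder_norm:
  assumes "monic_orthogonal (ladder n) k P" and "\<And>j. 1 \<le> j \<Longrightarrow> j \<le> k \<Longrightarrow> \<gamma> j \<noteq> 0"
  shows "(- \<kappa>) ^ k * (\<Prod>i<k. d (2 * n + k - 1 + i)) * ladder n (P ^ 2)
    = (\<Prod>i<k. \<gamma> (Suc i)) * ladder (n + k) 1"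
  using assms
proof (induction k arbitrary: n P)
  case 0
  then have "P = 1"
    by (auto simp: monic_orthogonal_def elim!: degree_eq_zeroE simp: one_pCons)
  then show ?case by simp
next
  case (Suc k)
  define Q where "Q = smult (inverse (\<gamma> (Suc k))) (D P)"
  have Q: "monic_orthogonal (ladder (Suc n)) k Q"
    "- \<kappa> * d (2 * n + k) * ladder n (P ^ 2) = \<gamma> (Suc k) * ladder (Suc n) (Q ^ 2)"
    using descend[OF Suc.prems(1)] Suc.prems(2)[of "Suc k"] by (simp_all add: Q_def del: ladder.simps)
  define p where "p = (\<Prod>i<k. d (2 * Suc n + k - 1 + i))"
  have IH: "(- \<kappa>) ^ k * p * ladder (Suc n) (Q ^ 2) = (\<Prod>i<k. \<gamma> (Suc i)) * ladder (Suc n + k) 1"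
    unfolding p_def using Suc.IH[OF Q(1)] Suc.prems(2) by (simp del: ladder.simps)
  have "(\<Prod>i<Suc k. d (2 * n + Suc k - 1 + i)) = d (2 * n + k) * p"
    unfolding prod.lessThan_Suc_shift p_def by simp
  then have "(- \<kappa>) ^ Suc k * (\<Prod>i<Suc k. d (2 * n + Suc k - 1 + i)) * ladder n (P ^ 2)
      = (- \<kappa>) ^ k * p * (- \<kappa> * d (2 * n + k) * ladder n (P ^ 2))"
    by simp
  also have "\<dots> = (- \<kappa>) ^ k * p * ladder (Suc n) (Q ^ 2) * \<gamma> (Suc k)"
    unfolding Q(2) by (simp only: mult_ac)
  also have "\<dots> = (\<Prod>i<Suc k. \<gamma> (Suc i)) * ladder (n + Suc k) 1"
    unfolding IH by (simp del: ladder.simps add: mult_ac)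
  finally show ?case .
qed

lemma ladder_\<Psi>: "ladder n (\<Psi> n) = 0"
  using pearson_ladder[of n 1] by (simp add: E_def)

lemma ladder_Suc_1:
  assumes nz: "d (2 * n) \<noteq> 0"
  shows "d (2 * n + 1) * ladder (Suc n) 1
    = \<kappa> * d (2 * n) * poly (\<Phi> n) (- e n / d (2 * n)) * ladder n 1"
proof -
  define t where "t = - e n / d (2 * n)"
  define q where "q = [:- t, 1:]"
  define v where "v = poly (\<Phi> n) t"
  note lin = functional_simps[OF functional_ladder]
  have \<Psi>: "\<Psi> n = smult (d (2 * n)) q"
    using nz by (simp add: \<Psi>_def q_def t_def)
  then have q0: "ladder n q = 0"
    using ladder_\<Psi>[of n] nz by (simp add: lin)
  have "\<Phi> n = smult v 1
      + smult (\<phi>1 * \<alpha> n + \<psi>0 * (\<kappa>\<^sup>2 - 1) * \<gamma> n + 2 * top_coeff n * t) q + smult (top_coeff n) (q ^ 2)"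
    by (simp add: v_def q_def \<Phi>_def one_pCons power2_eq_square algebra_simps)
  then have L1: "ladder n (\<Phi> n) = v * ladder n 1 + top_coeff n * ladder n (q ^ 2)"
    by (simp only: lin q0) simp
  have "E (\<Phi> n) (\<Psi> n) q = \<Phi> n + smult (\<kappa> * d (2 * n)) (q ^ 2) + smult ((\<kappa> - 1) * t * d (2 * n)) q"
    unfolding E_def \<Psi> by (simp add: q_def D_linear S_linear power2_eq_square algebra_simps)
  then have L2: "ladder n (\<Phi> n) + \<kappa> * d (2 * n) * ladder n (q ^ 2) = 0"
    using pearson_ladder[of n q] by (simp add: lin q0)
  have "ladder (Suc n) 1 = ladder n (\<Phi> n)"
    by (simp add: F_def)
  moreover have "d (2 * n + 1) = top_coeff n + \<kappa> * d (2 * n)"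
    by (simp add: d top_coeff_def \<alpha>_Suc \<gamma>_Suc algebra_simps)
  moreover have "(top_coeff n + \<kappa> * d (2 * n)) * ladder n (\<Phi> n) = \<kappa> * d (2 * n) * v * ladder n 1"
    using L1 L2 by algebra
  ultimately show ?thesis
    by (simp add: v_def t_def)
qed

lemma subleading_coeff:
  assumes "monic_orthogonal (ladder n) (Suc k) P" and "\<And>j. 1 \<le> j \<Longrightarrow> j \<le> Suc k \<Longrightarrow> \<gamma> j \<noteq> 0"
    and "d (2 * (n + k)) \<noteq> 0" and "ladder (n + k) 1 \<noteq> 0"
  shows "coeff P k = \<gamma> (Suc k) * e (n + k) / d (2 * (n + k))"
  using assms
proof (induction k arbitrary: n P)
  case 0
  define t where "t = coeff P 0"
  have "degree P = 1" "coeff P 1 = 1" "ladder n P = 0"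
    using 0 by (auto simp: monic_orthogonal_def dest: spec[of _ 1])
  then have P: "P = [:t, 1:]" and "ladder n P = 0"
    unfolding t_def by (auto intro!: poly_eqI simp: coeff_pCons coeff_eq_0 split: nat.split)
  have "smult (d (2 * n)) P = \<Psi> n + smult (d (2 * n) * t - e n) 1"
    by (simp add: P \<Psi>_def one_pCons)
  then have "(d (2 * n) * t - e n) * ladder n 1 = 0"
    using \<open>ladder n P = 0\<close> ladder_\<Psi>[of n] functional_add[OF functional_ladder]
      functional_smult[OF functional_ladder] by (metis add_0 mult_zero_right)
  then show ?case
    using 0 by (simp add: t_def \<gamma>_Suc \<gamma>_0 \<alpha>_0 field_simps)
next
  case (Suc k)
  define Q where "Q = smult (inverse (\<gamma> (Suc (Suc k)))) (D P)"
  have \<gamma>: "\<gamma> (Suc k) \<noteq> 0" "\<gamma> (Suc (Suc k)) \<noteq> 0"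
    using Suc.prems(2) by auto
  have Q: "monic_orthogonal (ladder (Suc n)) (Suc k) Q"
    using descend(1)[OF Suc.prems(1)] \<gamma> by (simp add: Q_def del: ladder.simps)
  have "coeff Q k = \<gamma> (Suc k) * e (Suc n + k) / d (2 * (Suc n + k))"
    by (rule Suc.IH[OF Q]) (use Suc.prems in \<open>auto simp del: ladder.simps\<close>)
  moreover have "coeff Q k = \<gamma> (Suc k) * coeff P (Suc k) / \<gamma> (Suc (Suc k))"
    using coeff_D[of P k] Suc.prems(1) by (simp add: Q_def monic_orthogonal_def field_simps)
  ultimately have "\<gamma> (Suc k) * (coeff P (Suc k) / \<gamma> (Suc (Suc k)))
      = \<gamma> (Suc k) * (e (n + Suc k) / d (2 * (n + Suc k)))"
    by simp
  then have "coeff P (Suc k) / \<gamma> (Suc (Suc k)) = e (n + Suc k) / d (2 * (n + Suc k))"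
    using \<gamma>(1) unfolding mult_cancel_left by blast
  then show ?case
    using \<gamma>(2) by (simp add: divide_eq_eq mult.commute)
qed

end

locale regular_pearson_ladder = pearson_ladder +
  fixes N :: nat
  assumes \<kappa>_nonzero: "\<kappa> \<noteq> 0" and u_1: "u 1 \<noteq> 0"
    and \<gamma>_nonzero: "\<And>k. 1 \<le> k \<Longrightarrow> k \<le> N + 1 \<Longrightarrow> \<gamma> k \<noteq> 0"
    and d_nonzero: "\<And>j. j \<le> 2 * N + 1 \<Longrightarrow> d j \<noteq> 0"
begin

definition v :: "nat \<Rightarrow> complex" where
  "v n = poly (\<Phi> n) (- e n / d (2 * n))"

lemma ladder_step:
  assumes "n \<le> N"
  shows "d (2 * n + 1) * ladder (Suc n) 1 = \<kappa> * d (2 * n) * v n * ladder n 1"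
  unfolding v_def by (rule ladder_Suc_1) (use assms d_nonzero in auto)

lemma ladder_1_nonzero_iff:
  assumes "k \<le> N + 1"
  shows "ladder k 1 \<noteq> 0 \<longleftrightarrow> (\<forall>n<k. v n \<noteq> 0)"
  using assms
proof (induction k)
  case 0
  then show ?case by (simp add: u_1)
next
  case (Suc k)
  have "ladder (Suc k) 1 \<noteq> 0 \<longleftrightarrow> v k * ladder k 1 \<noteq> 0"
  proof -
    have k: "k \<le> N" using Suc.prems by simp
    have "d (2 * k + 1) * ladder (Suc k) 1 \<noteq> 0 \<longleftrightarrow> v k * ladder k 1 \<noteq> 0"
      unfolding ladder_step[OF k] using k d_nonzero[of "2 * k"] \<kappa>_nonzero by simp
    then show ?thesis
      using k d_nonzero[of "2 * k + 1"] by (simp del: ladder.simps)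
  qed
  with Suc show ?case
    by (auto simp: less_Suc_eq simp del: ladder.simps)
qed

lemma norm_eq:
  assumes "monic_orthogonal u k P" "k \<le> N + 1"
  shows "(- \<kappa>) ^ k * (\<Prod>i<k. d (k - 1 + i)) * u (P ^ 2) = (\<Prod>i<k. \<gamma> (Suc i)) * ladder k 1"
  using ladder_norm[of 0 k P] assms \<gamma>_nonzero by simp

lemma norm_nonzero_iff:
  assumes "monic_orthogonal u k P" "k \<le> N + 1"
  shows "u (P ^ 2) \<noteq> 0 \<longleftrightarrow> ladder k 1 \<noteq> 0"
proof -
  have "d (k - 1 + i) \<noteq> 0" "\<gamma> (Suc i) \<noteq> 0" if "i < k" for i
    using that assms(2) d_nonzero[of "k - 1 + i"] \<gamma>_nonzero[of "Suc i"] by auto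
  then have nz: "(\<Prod>i<k. d (k - 1 + i)) \<noteq> 0" "(\<Prod>i<k. \<gamma> (Suc i)) \<noteq> 0"
    by auto
  have "u (P ^ 2) \<noteq> 0 \<longleftrightarrow> (- \<kappa>) ^ k * (\<Prod>i<k. d (k - 1 + i)) * u (P ^ 2) \<noteq> 0"
    using nz(1) \<kappa>_nonzero by simp
  also have "\<dots> \<longleftrightarrow> ladder k 1 \<noteq> 0"
    unfolding norm_eq[OF assms] using nz(2) by simp
  finally show ?thesis .
qed

lemma regular_imp_v_nonzero:
  assumes "regular_of_order (N + 2) u"
  shows "\<forall>n\<le>N. v n \<noteq> 0"
proof -
  obtain P where P: "monic_orthogonal_family {..<N + 2} u P"
    using assms monic_orthogonal_familyI[OF functional_u] by (auto simp: regular_of_order_def)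
  have "u (P (N + 1) ^ 2) \<noteq> 0"
    using P by (auto simp: monic_orthogonal_family_def orthogonal_family_def)
  moreover have "monic_orthogonal u (N + 1) (P (N + 1))"
    using monic_orthogonal_family_nth[OF functional_u P] by simp
  ultimately have "ladder (N + 1) 1 \<noteq> 0"
    using norm_nonzero_iff by blast
  then show ?thesis
    using ladder_1_nonzero_iff[of "N + 1"] by auto
qed

lemma v_nonzero_imp_regular:
  assumes v: "\<forall>n\<le>N. v n \<noteq> 0"
  shows "regular_of_order (N + 2) u"
proof -
  have "\<exists>P. orthogonal_family {..<m} u P" if "m \<le> N + 2" for m
    using that
  proof (induction m)
    case 0
    then show ?case by (simp add: orthogonal_family_def)
  next
    case (Suc m)
    then obtain P where P: "orthogonal_family {..<m} u P" by auto
    obtain Q where Q: "monic_orthogonal u m Q"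
      using monic_orthogonal_exists[OF functional_u P] by blast
    have "u (Q ^ 2) \<noteq> 0"
      using norm_nonzero_iff[OF Q] ladder_1_nonzero_iff[of m] v Suc.prems by auto
    then show ?case
      using orthogonal_family_append[OF functional_u P Q] by blast
  qed
  then show ?thesis
    by (auto simp: regular_of_order_def)
qed

lemma regular_iff: "regular_of_order (N + 2) u \<longleftrightarrow> (\<forall>n\<le>N. v n \<noteq> 0)"
  using regular_imp_v_nonzero v_nonzero_imp_regular by blast

lemma norm_ratio:
  assumes P: "monic_orthogonal_family {..<N + 2} u P" and n: "n \<le> N"
  shows "u (P (n + 1) ^ 2) / u (P n ^ 2) = - (\<gamma> (n + 1) * d (n - 1) / (d (2 * n - 1) * d (2 * n + 1))) * v n"
proof -
  define H H' where "H = u (P n ^ 2)" and "H' = u (P (n + 1) ^ 2)"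
  define G where "G = (\<Prod>i<n. \<gamma> (Suc i))"
  define p p' where "p = (\<Prod>i<n. d (n - 1 + i))" and "p' = (\<Prod>i<Suc n. d (n + i))"
  have H: "H \<noteq> 0"
    using P n by (auto simp: H_def monic_orthogonal_family_def orthogonal_family_def)
  have "d (n - 1 + i) \<noteq> 0" if "i < n" for i
    using that n d_nonzero[of "n - 1 + i"] by auto
  then have p: "p \<noteq> 0"
    by (auto simp: p_def)
  have dnz: "d (n - 1) \<noteq> 0" "d (2 * n - 1) \<noteq> 0" "d (2 * n) \<noteq> 0" "d (2 * n + 1) \<noteq> 0"
    using n by (auto intro!: d_nonzero)
  have 1: "(- \<kappa>) ^ n * p * H = G * ladder n 1"
    using norm_eq[OF monic_orthogonal_family_nth[OF functional_u P, of n]] n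
    by (simp add: p_def G_def H_def)
  have "(- \<kappa>) ^ Suc n * p' * H' = (\<Prod>i<Suc n. \<gamma> (Suc i)) * ladder (Suc n) 1"
    using norm_eq[OF monic_orthogonal_family_nth[OF functional_u P, of "Suc n"]] n
    unfolding p'_def H'_def by (simp del: ladder.simps prod.lessThan_Suc)
  then have 2: "(- \<kappa>) ^ n * (- \<kappa>) * p' * H' = G * \<gamma> (n + 1) * ladder (Suc n) 1"
    by (simp add: G_def mult.commute del: ladder.simps)
  have "(- \<kappa>) ^ n * (- \<kappa>) * (p' * H' * d (2 * n + 1))
      = ((- \<kappa>) ^ n * (- \<kappa>) * p' * H') * d (2 * n + 1)"
    by (simp only: mult_ac)
  also have "\<dots> = G * \<gamma> (n + 1) * (d (2 * n + 1) * ladder (Suc n) 1)"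
    unfolding 2 by (simp only: mult_ac)
  also have "\<dots> = \<gamma> (n + 1) * \<kappa> * d (2 * n) * v n * (G * ladder n 1)"
    unfolding ladder_step[OF n] by (simp only: mult_ac)
  also have "\<dots> = (- \<kappa>) ^ n * (- \<kappa>) * (- \<gamma> (n + 1) * d (2 * n) * v n * p * H)"
    unfolding 1[symmetric] by simp
  finally have 3: "p' * H' * d (2 * n + 1) = - \<gamma> (n + 1) * d (2 * n) * v n * p * H"
    using \<kappa>_nonzero unfolding mult_cancel_left by simp
  have 4: "d (n - 1) * p' = p * d (2 * n - 1) * d (2 * n)"
  proof (cases n)
    case 0
    then show ?thesis by (simp add: p_def p'_def)
  next
    case (Suc m)
    have "d m * (\<Prod>i<m + 2. d (m + Suc i)) = (\<Prod>i<m + 3. d (m + i))"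
      using prod.lessThan_Suc_shift[of "\<lambda>i. d (m + i)" "m + 2"] by (auto simp: eval_nat_numeral)
    also have "\<dots> = (\<Prod>i<m + 1. d (m + i)) * d (2 * m + 1) * d (2 * m + 2)"
      by (simp add: eval_nat_numeral mult_2)
    finally show ?thesis
      by (simp add: p_def p'_def Suc)
  qed
  have "p * d (2 * n) * (H' * (d (2 * n - 1) * d (2 * n + 1))) = d (n - 1) * (p' * H' * d (2 * n + 1))"
    using arg_cong[OF 4, of "\<lambda>x. x * (H' * d (2 * n + 1))"] by (simp only: mult_ac)
  also have "\<dots> = p * d (2 * n) * (- \<gamma> (n + 1) * d (n - 1) * v n * H)"
    unfolding 3 by (simp only: mult_ac)
  finally have "H' * (d (2 * n - 1) * d (2 * n + 1)) = - \<gamma> (n + 1) * d (n - 1) * v n * H"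
    using p dnz(3) unfolding mult_cancel_left mult_eq_0_iff by blast
  then have "H' = - \<gamma> (n + 1) * d (n - 1) * v n * H / (d (2 * n - 1) * d (2 * n + 1))"
    using dnz(2,4) by (simp only: nonzero_eq_divide_eq no_zero_divisors not_False_eq_True)
  then show ?thesis
    unfolding H_def[symmetric] H'_def[symmetric] using H by simp
qed

lemma subleading:
  assumes P: "monic_orthogonal_family {..<N + 2} u P" and n: "n \<le> N"
  shows "coeff (P (n + 1)) n = \<gamma> (n + 1) * e n / d (2 * n)"
proof -
  have "regular_of_order (N + 2) u"
    using P by (auto simp: regular_of_order_def monic_orthogonal_family_def)
  then have "ladder n 1 \<noteq> 0"
    using regular_iff ladder_1_nonzero_iff[of n] n by auto
  then show ?thesis
    using subleading_coeff[of 0 n "P (n + 1)"] monic_orthogonal_family_nth[OF functional_u P, of "n + 1"]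
      n \<gamma>_nonzero d_nonzero[of "2 * n"]
    by simp
qed

lemma recurrence:
  assumes P: "monic_orthogonal_family {..<N + 2} u P" and n: "n \<le> N"
  shows "P (n + 1) = [:- (\<gamma> n * e (n - 1) / d (2 * n - 2) - \<gamma> (n + 1) * e n / d (2 * n)), 1:] * P n
    - (if n = 0 then 0
       else smult (- (\<gamma> n * d (n - 2) / (d (2 * n - 3) * d (2 * n - 1))) * v (n - 1)) (P (n - 1)))"
proof -
  have c1: "(if n = 0 then 0 else coeff (P n) (n - 1)) = \<gamma> n * e (n - 1) / d (2 * n - 2)"
    using subleading[OF P, of "n - 1"] n by (cases n) (auto simp: \<gamma>_0)
  have c2: "coeff (P (Suc n)) n = \<gamma> (n + 1) * e n / d (2 * n)"
    using subleading[OF P n] by simp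
  have "u (P n ^ 2) / u (P (n - 1) ^ 2) = - (\<gamma> n * d (n - 2) / (d (2 * n - 3) * d (2 * n - 1))) * v (n - 1)"
    if "n \<noteq> 0"
    using norm_ratio[OF P, of "n - 1"] n that by (cases n) (auto simp: numeral_3_eq_3 numeral_2_eq_2)
  then have c3: "(if n = 0 then 0 else smult (u (P n ^ 2) / u (P (n - 1) ^ 2)) (P (n - 1)))
    = (if n = 0 then 0
       else smult (- (\<gamma> n * d (n - 2) / (d (2 * n - 3) * d (2 * n - 1))) * v (n - 1)) (P (n - 1)))"
    by auto
  show ?thesis
    using three_term_recurrence[OF functional_u P, of n] n unfolding c1 c2 c3 by simp
qed

end

section \<open>Admissible lattices and translation to the centre\<close>

lemma admissible_infinite: "admissible h U X \<Longrightarrow> infinite (X ` U)"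
  by (simp add: admissible_def)

lemma admissible_step: "admissible h U X \<Longrightarrow> s \<in> U \<Longrightarrow> X (s + h / 2) \<noteq> X (s - h / 2)"
  by (auto simp: admissible_def parametrising_def)

lemma admissible_quotient:
  assumes "admissible h U X" and "degree p \<ge> 1"
  obtains Q where "degree Q \<le> degree p - 1"
    and "\<forall>s\<in>U. poly Q (X s) =
      (poly p (X (s + h / 2)) - poly p (X (s - h / 2))) / (X (s + h / 2) - X (s - h / 2))"
proof -
  obtain Q where "degree Q \<le> degree p - 1"
    "\<forall>s\<in>U. (poly p (X (s + h / 2)) - poly p (X (s - h / 2))) / (X (s + h / 2) - X (s - h / 2))
      = poly Q (X s)"
    using assms unfolding admissible_def by blast
  then show thesis
    by (intro that[of Q]) simp_all
qed

lemma divdiff_at: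
  assumes X: "admissible h U X" and s: "s \<in> U"
  shows "poly (divdiff h U X p) (X s) * (X (s + h / 2) - X (s - h / 2))
    = poly p (X (s + h / 2)) - poly p (X (s - h / 2))"
proof -
  let ?char = "\<lambda>Q. \<forall>s\<in>U. poly Q (X s) =
     (poly p (X (s + h / 2)) - poly p (X (s - h / 2))) / (X (s + h / 2) - X (s - h / 2))"
  have "\<exists>Q. ?char Q"
  proof (cases "degree p")
    case 0
    then obtain r where "p = [:r:]"
      by (rule degree_eq_zeroE)
    then show ?thesis
      by (intro exI[of _ 0]) simp
  next
    case (Suc n)
    then have "degree p \<ge> 1" by simp
    from X this show ?thesis
      by (rule admissible_quotient) (erule exI)
  qed
  moreover have "Q = R" if "?char Q" "?char R" for Q R
    by (rule poly_eqI_infinite[OF admissible_infinite[OF X]]) (simp add: that)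
  ultimately have "\<exists>!Q. ?char Q"
    by (rule ex_ex1I)
  then have "?char (divdiff h U X p)"
    unfolding divdiff_def by (rule theI')
  then show ?thesis
    using s admissible_step[OF X s] by simp
qed

lemma average_at:
  assumes X: "admissible h U X" and \<eta>\<beta>: "\<forall>s\<in>U. X (s + h / 2) + X (s - h / 2) = \<eta> * X s + \<beta>"
    and s: "s \<in> U"
  shows "2 * poly (average h U X p) (X s) = poly p (X (s + h / 2)) + poly p (X (s - h / 2))"
proof -
  let ?char = "\<lambda>Q. \<forall>s\<in>U. poly Q (X s) = (poly p (X (s + h / 2)) + poly p (X (s - h / 2))) / 2"
  define Q where "Q = divdiff h U X ([:0, 1:] * p) - smult (1 / 2) ([:\<beta>, \<eta>:] * divdiff h U X p)"
  have "?char Q"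
  proof
    fix s assume s: "s \<in> U"
    define x y z where "x = X s" and "y = X (s + h / 2)" and "z = X (s - h / 2)"
    have "2 * poly Q x * (y - z) = 2 * (poly (divdiff h U X ([:0, 1:] * p)) x * (y - z))
        - (\<eta> * x + \<beta>) * (poly (divdiff h U X p) x * (y - z))"
      by (simp add: Q_def algebra_simps)
    also have "\<dots> = 2 * (y * poly p y - z * poly p z) - (y + z) * (poly p y - poly p z)"
      using divdiff_at[OF X s, of "[:0, 1:] * p"] divdiff_at[OF X s, of p] \<eta>\<beta> s
      by (simp add: x_def y_def z_def)
    also have "\<dots> = (poly p y + poly p z) * (y - z)"
      by (simp add: algebra_simps)
    finally have "2 * poly Q x = poly p y + poly p z"
      using admissible_step[OF X s] unfolding mult_cancel_right by (simp add: y_def z_def)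
    then show "poly Q (X s) = (poly p (X (s + h / 2)) + poly p (X (s - h / 2))) / 2"
      by (simp add: x_def y_def z_def eq_divide_eq mult.commute)
  qed
  then have "\<exists>Q. ?char Q" ..
  moreover have "Q = R" if "?char Q" "?char R" for Q R
    by (rule poly_eqI_infinite[OF admissible_infinite[OF X]]) (simp add: that)
  ultimately have "\<exists>!Q. ?char Q"
    by (rule ex_ex1I)
  then have "?char (average h U X p)"
    unfolding average_def by (rule theI')
  then show ?thesis
    using s by (simp add: mult.commute)
qed

text \<open>
  Both sides of the defining relation of the invariant below equal
  \<open>4 (X(s + h/2)\<^sup>2 - 2 \<kappa> X(s) X(s + h/2) + X(s)\<^sup>2)\<close>, which is symmetric under exchanging
  \<open>s\<close> and \<open>s + h/2\<close>. By admissibility at degree 3 the invariant is a polynomial in \<open>X(s)\<close>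
  of degree at most 2, and such a polynomial can only be half-step periodic if it is constant.
\<close>

lemma half_step_discriminant_constant:
  fixes \<kappa> c :: complex
  assumes U: "half_step_invariant h U" and X: "admissible h U X" and \<kappa>: "\<kappa> \<noteq> 0"
    and sum: "\<And>s. s \<in> U \<Longrightarrow> (X (s + h / 2) - c) + (X (s - h / 2) - c) = 2 * \<kappa> * (X s - c)"
  obtains k where "\<And>s. s \<in> U \<Longrightarrow>
    (X (s + h / 2) - X (s - h / 2))\<^sup>2 = 4 * (\<kappa>\<^sup>2 - 1) * (X s - c)\<^sup>2 + k"
proof -
  have up: "s + h / 2 \<in> U" and down: "s - h / 2 \<in> U" if "s \<in> U" for s
    using U that by (auto simp: half_step_invariant_def)
  note nz = admissible_step[OF X]
  define f where "f s = (X (s + h / 2) - X (s - h / 2))\<^sup>2 - 4 * (\<kappa>\<^sup>2 - 1) * (X s - c)\<^sup>2" for s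
  have f_up: "f (s + h / 2) = f s" if s: "s \<in> U" for s
  proof -
    define x y where "x = X s - c" and "y = X (s + h / 2) - c"
    have 1: "X (s + h / 2 + h / 2) - X (s + h / 2 - h / 2) = 2 * (\<kappa> * y - x)"
      using sum[OF up[OF s]] by (simp add: x_def y_def algebra_simps)
    have 2: "X (s + h / 2) - X (s - h / 2) = 2 * (y - \<kappa> * x)"
      using sum[OF s] by (simp add: x_def y_def algebra_simps)
    show ?thesis
      unfolding f_def 1 2 x_def[symmetric] y_def[symmetric]
      by (simp add: power2_eq_square algebra_simps)
  qed
  have f_step: "f (s + h / 2) = f (s - h / 2)" if "s \<in> U" for s
    using f_up[OF that] f_up[OF down[OF that]] by simp
  have deg: "degree ([:- c, 1:] ^ 3 :: complex poly) = 3"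
    by (simp add: degree_power_eq)
  obtain Q where "degree Q \<le> degree ([:- c, 1:] ^ 3 :: complex poly) - 1"
    and Q: "\<forall>s\<in>U. poly Q (X s) = (poly ([:- c, 1:] ^ 3) (X (s + h / 2))
      - poly ([:- c, 1:] ^ 3) (X (s - h / 2))) / (X (s + h / 2) - X (s - h / 2))"
    by (rule admissible_quotient[OF X, of "[:- c, 1:] ^ 3"]) (simp add: deg)
  then have "degree Q \<le> 2"
    by (simp add: deg)
  define R where "R = pcompose Q [:c, 1:] * [:4:] - [:0, 0, 16 * \<kappa>\<^sup>2 - 4:]"
  have "degree (pcompose Q [:c, 1:] * [:4:]) \<le> 2" "degree [:0, 0, 16 * \<kappa>\<^sup>2 - 4:] \<le> 2"
    using \<open>degree Q \<le> 2\<close> by (simp_all add: degree_pcompose)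
  then have "degree R \<le> 2"
    unfolding R_def by (rule degree_diff_le)
  define r0 r1 r2 where "r0 = coeff R 0" and "r1 = coeff R 1" and "r2 = coeff R 2"
  have R: "R = [:r0, r1, r2:]"
    using \<open>degree R \<le> 2\<close>
    by (intro poly_eqI)
      (auto simp: r0_def r1_def r2_def coeff_pCons coeff_eq_0 numeral_2_eq_2 split: nat.split)
  have f_R: "f s = poly R (X s - c)" if s: "s \<in> U" for s
  proof -
    define x y z where "x = X s - c" and "y = X (s + h / 2) - c" and "z = X (s - h / 2) - c"
    have yz: "y + z = 2 * \<kappa> * x"
      using sum[OF s] by (simp add: x_def y_def z_def)
    have "y - z \<noteq> 0" and 1: "X (s + h / 2) - X (s - h / 2) = y - z"
      using nz[OF s] by (auto simp: y_def z_def)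
    have "poly Q (X s) = (y ^ 3 - z ^ 3) / (y - z)"
      using bspec[OF Q s] by (simp add: y_def z_def)
    also have "y ^ 3 - z ^ 3 = (y\<^sup>2 + y * z + z\<^sup>2) * (y - z)"
      by (simp add: power2_eq_square power3_eq_cube algebra_simps)
    finally have "poly Q (X s) = y\<^sup>2 + y * z + z\<^sup>2"
      using \<open>y - z \<noteq> 0\<close> by simp
    then have "poly R x = 4 * (y\<^sup>2 + y * z + z\<^sup>2) - 3 * (2 * \<kappa> * x)\<^sup>2 - 4 * (\<kappa>\<^sup>2 - 1) * x\<^sup>2"
      by (simp add: R_def poly_pcompose x_def[symmetric] power2_eq_square algebra_simps)
        (simp add: x_def)
    also have "\<dots> = (y - z)\<^sup>2 - 4 * (\<kappa>\<^sup>2 - 1) * x\<^sup>2"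
      unfolding yz[symmetric] by (simp add: power2_eq_square algebra_simps)
    finally show ?thesis
      by (simp add: f_def 1 x_def)
  qed
  have "poly [:r1 - 2 * \<kappa> * r2 * c, 2 * \<kappa> * r2:] (X s) = poly 0 (X s)" if s: "s \<in> U" for s
  proof -
    define x y z where "x = X s - c" and "y = X (s + h / 2) - c" and "z = X (s - h / 2) - c"
    have yz: "y + z = 2 * \<kappa> * x"
      using sum[OF s] by (simp add: x_def y_def z_def)
    have "(y - z) * (r1 + r2 * (y + z)) = 0"
      using f_step[OF s] f_R[OF up[OF s]] f_R[OF down[OF s]]
      by (simp add: R y_def[symmetric] z_def[symmetric] algebra_simps)
    moreover have "y - z \<noteq> 0"
      using nz[OF s] by (simp add: y_def z_def)
    ultimately have "r1 + r2 * (2 * \<kappa> * x) = 0"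
      by (simp add: yz)
    then show ?thesis
      by (simp add: x_def algebra_simps)
  qed
  then have "[:r1 - 2 * \<kappa> * r2 * c, 2 * \<kappa> * r2:] = 0"
    by (rule poly_eqI_infinite[OF admissible_infinite[OF X]])
  then have "r1 = 0" "r2 = 0"
    using \<kappa> by auto
  then have "(X (s + h / 2) - X (s - h / 2))\<^sup>2 = 4 * (\<kappa>\<^sup>2 - 1) * (X s - c)\<^sup>2 + r0" if "s \<in> U" for s
    using f_R[OF that] by (simp add: R f_def algebra_simps)
  then show ?thesis
    using that by blast
qed

lemma pcompose_shift_inverse: "pcompose (pcompose p [:r, 1:]) [:- r, 1:] = (p :: complex poly)"
  by (simp add: pcompose_assoc[symmetric] pcompose_pCons)

lemma functional_shift: "functional u \<Longrightarrow> functional (\<lambda>p. u (pcompose p q))"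
  by (rule functionalI) (simp_all add: pcompose_add pcompose_smult functional_simps)

lemma orthogonal_family_shift:
  assumes "orthogonal_family I u P"
  shows "orthogonal_family I (\<lambda>p. u (pcompose p [:- c, 1:])) (\<lambda>n. pcompose (P n) [:c, 1:])"
  using assms
  by (simp add: orthogonal_family_def degree_pcompose pcompose_mult pcompose_shift_inverse
      power2_eq_square)

lemma regular_of_order_shift:
  "regular_of_order m (\<lambda>p. u (pcompose p [:- c, 1:])) \<longleftrightarrow> regular_of_order m u"
proof
  assume "regular_of_order m u"
  then show "regular_of_order m (\<lambda>p. u (pcompose p [:- c, 1:]))"
    using orthogonal_family_shift unfolding regular_of_order_def by blast
next
  assume "regular_of_order m (\<lambda>p. u (pcompose p [:- c, 1:]))"
  then obtain P where "orthogonal_family {..<m} (\<lambda>p. u (pcompose p [:- c, 1:])) P"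
    by (auto simp: regular_of_order_def)
  from orthogonal_family_shift[OF this, of "- c"] show "regular_of_order m u"
    using pcompose_shift_inverse[of _ c] by (auto simp: regular_of_order_def)
qed

lemma monic_orthogonal_family_shift:
  assumes "monic_orthogonal_family I u P"
  shows "monic_orthogonal_family I (\<lambda>p. u (pcompose p [:- c, 1:])) (\<lambda>n. pcompose (P n) [:c, 1:])"
  using assms orthogonal_family_shift[of I u P c]
  by (simp add: monic_orthogonal_family_def lead_coeff_comp)

theorem corollary7p11:
  fixes h :: complex and U :: "complex set" and X :: "complex \<Rightarrow> complex"
    and u :: "complex poly \<Rightarrow> complex"
    and \<phi> \<psi> :: "complex poly" and \<phi>0 \<phi>1 \<phi>2 \<psi>0 \<psi>1 :: complex
    and \<eta> \<beta> A B q qh s0 a b c \<Pi> :: complex and \<nu> N :: nat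
    and \<alpha> \<gamma> d e :: "nat \<Rightarrow> complex" and \<phi>n :: "nat \<Rightarrow> complex \<Rightarrow> complex"
    and Bn Cn :: "nat \<Rightarrow> complex"
  assumes h: "h \<noteq> 0"
    and U: "half_step_invariant h U"
    and X: "admissible h U X"
    and u: "functional u" "u 1 \<noteq> 0"
    and \<phi>: "\<phi> = [:\<phi>0, \<phi>1, \<phi>2:]"
    and \<psi>: "\<psi> = [:\<psi>0, \<psi>1:]"
    and nontrivial: "\<not> (\<phi> = 0 \<and> \<psi> = 0)"
    and equation: "divdiff_dual h U X (mult_functional \<phi> u) = average_dual h U X (mult_functional \<psi> u)"
    and \<eta>\<beta>: "\<forall>s\<in>U. X (s + h / 2) + X (s - h / 2) = \<eta> * X s + \<beta>"
    and A: "A = \<eta>\<^sup>2 - 2"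
    and B: "B = (\<eta> + 2) * \<beta>"
    and q_exponential: "\<eta> \<notin> {0, 2, -2}"
    and q: "q + inverse q = A"
    and primitive: "primitive_root_of_unity \<nu> q" "\<nu> \<ge> 3"
    and qh: "qh\<^sup>2 = q" "qh + inverse qh = \<eta>"
    and s0: "s0 \<in> U"
    and c: "c = B / (2 - A)"
    and ab: "\<forall>k :: int. X (s0 + of_int k * h) = a * q powi k + b * q powi (- k) + c"
    and \<Pi>: "\<Pi> = a * b"
    and \<alpha>: "\<And>n. \<alpha> n = (qh powi int n + qh powi (- int n)) / 2"
    and \<gamma>: "\<And>n. \<gamma> n = (qh powi int n - qh powi (- int n)) / (qh - inverse qh)"
    and d: "\<And>n. d n = \<phi>2 * \<gamma> n + \<psi>1 * \<alpha> n"
    and e: "\<And>n. e n = (2 * \<phi>2 * c + \<phi>1) * \<gamma> n + (\<psi>1 * c + \<psi>0) * \<alpha> n"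
    and \<phi>n: "\<And>n x. \<phi>n n x =
          (\<psi>1 * ((\<alpha> 1)\<^sup>2 - 1) * \<gamma> (2 * n) + \<phi>2 * \<alpha> (2 * n)) * ((x - c)\<^sup>2 - 2 * \<Pi>)
          + (poly (pderiv \<phi>) c * \<alpha> n + poly \<psi> c * ((\<alpha> 1)\<^sup>2 - 1) * \<gamma> n) * (x - c)
          + poly \<phi> c + 2 * \<phi>2 * \<Pi>"
    and N: "N + 1 < \<nu>"
    and d_nonzero: "\<forall>j \<le> 2 * N + 1. d j \<noteq> 0"
    and B0: "Bn 0 = c - \<gamma> 1 * e 0 / d 0"
    and C1: "Cn 1 = - (\<gamma> 1 / d 1) * \<phi>n 0 (c - e 0 / d 0)"
    and Bn: "\<And>n. 1 \<le> n \<Longrightarrow> n \<le> N \<Longrightarrow>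
          Bn n = c + \<gamma> n * e (n - 1) / d (2 * n - 2) - \<gamma> (n + 1) * e n / d (2 * n)"
    and Cn: "\<And>n. 1 \<le> n \<Longrightarrow> n \<le> N \<Longrightarrow>
          Cn (n + 1) = - (\<gamma> (n + 1) * d (n - 1) / (d (2 * n - 1) * d (2 * n + 1)))
                       * \<phi>n n (c - e n / d (2 * n))"
  shows "(regular_of_order (N + 2) u \<longleftrightarrow> (\<forall>n \<le> N. \<phi>n n (c - e n / d (2 * n)) \<noteq> 0)) \<and>
    (regular_of_order (N + 2) u \<longrightarrow>
      (\<exists>P. monic_orthogonal_family {..N + 1} u P) \<and>
      (\<forall>P. monic_orthogonal_family {..N + 1} u P \<longrightarrow>
         P 0 = 1 \<and>
         (\<forall>n \<le> N. P (n + 1) = [:- Bn n, 1:] * P n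
                     - (if n = 0 then 0 else smult (Cn n) (P (n - 1)))) \<and>
         Cn (N + 1) = u (P (N + 1) ^ 2) / u (P N ^ 2)))"
proof -
  define \<kappa> where "\<kappa> = \<eta> / 2"
  define \<phi>0' \<phi>1' \<psi>0' where "\<phi>0' = poly \<phi> c" and "\<phi>1' = poly (pderiv \<phi>) c" and "\<psi>0' = poly \<psi> c"
  define D S where "D p = pcompose (divdiff h U X (pcompose p [:- c, 1:])) [:c, 1:]"
    and "S p = pcompose (average h U X (pcompose p [:- c, 1:])) [:c, 1:]" for p
  define u' where "u' p = u (pcompose p [:- c, 1:])" for p
  have \<kappa>: "\<kappa> \<noteq> 0"
    using q_exponential by (simp add: \<kappa>_def)
  have qh0: "qh \<noteq> 0"
    using qh(2) q_exponential by auto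
  have \<eta>_eq: "2 * \<kappa> = qh + inverse qh"
    by (simp add: \<kappa>_def qh(2))
  have \<delta>: "qh - inverse qh \<noteq> 0"
  proof
    assume "qh - inverse qh = 0"
    then have "inverse qh = qh"
      by simp
    then have "\<eta> = 2 * qh" "qh * qh = 1"
      using qh(2) qh0 right_inverse[of qh] by simp_all
    then show False
      using q_exponential by (auto simp: square_eq_1_iff)
  qed
  have \<kappa>_sq: "4 * (\<kappa>\<^sup>2 - 1) = (qh - inverse qh)\<^sup>2"
  proof -
    have "4 * (\<kappa>\<^sup>2 - 1) = (2 * \<kappa>)\<^sup>2 - 4"
      by (simp add: power2_eq_square algebra_simps)
    then show ?thesis
      unfolding \<eta>_eq using qh0 by (simp add: power2_eq_square field_simps)
  qed
  have c_eq: "(2 - \<eta>) * c = \<beta>"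
  proof -
    have "2 - \<eta> \<noteq> 0" "2 + \<eta> \<noteq> 0"
      using q_exponential by (auto simp: add_eq_0_iff)
    moreover have "2 - A = (2 - \<eta>) * (2 + \<eta>)"
      by (simp add: A power2_eq_square algebra_simps)
    ultimately show ?thesis
      by (simp add: c B add.commute)
  qed
  have sum: "(X (s + h / 2) - c) + (X (s - h / 2) - c) = 2 * \<kappa> * (X s - c)" if "s \<in> U" for s
    using bspec[OF \<eta>\<beta> that] c_eq by (simp add: \<kappa>_def algebra_simps)
  obtain k where k: "\<And>s. s \<in> U \<Longrightarrow>
      (X (s + h / 2) - X (s - h / 2))\<^sup>2 = 4 * (\<kappa>\<^sup>2 - 1) * (X s - c)\<^sup>2 + k"
    using half_step_discriminant_constant[OF U X \<kappa> sum] by blast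
  have up: "s + h / 2 \<in> U" and down: "s - h / 2 \<in> U" if "s \<in> U" for s
    using U that by (auto simp: half_step_invariant_def)
  have k_eq: "k = - 16 * (\<kappa>\<^sup>2 - 1) * \<Pi>"
  proof -
    define x y where "x = X s0 - c" and "y = X (s0 + h / 2) - c"
    have x: "x = a + b"
      using ab[THEN spec, of 0] by (simp add: x_def)
    have "X (s0 + h / 2 + h / 2) - c = a * q + b * inverse q"
      using ab[THEN spec, of 1] by (simp add: power_int_minus add.assoc)
    then have "2 * \<kappa> * y = (a * q + b * inverse q) + (a + b)"
      unfolding y_def sum[OF up[OF s0], symmetric] by (simp add: x[symmetric] x_def)
    also have "\<dots> = 2 * \<kappa> * (a * qh + b * inverse qh)"
      unfolding \<eta>_eq qh(1)[symmetric] using qh0 by (simp add: power2_eq_square field_simps)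
    finally have y: "y = a * qh + b * inverse qh"
      using \<kappa> by simp
    have "X (s0 + h / 2) - X (s0 - h / 2) = 2 * y - 2 * \<kappa> * x"
      using sum[OF s0] by (simp add: x_def y_def algebra_simps)
    also have "\<dots> = (qh - inverse qh) * (a - b)"
      unfolding x y \<eta>_eq by (simp add: algebra_simps)
    finally have step: "X (s0 + h / 2) - X (s0 - h / 2) = (qh - inverse qh) * (a - b)" .
    have "(qh - inverse qh)\<^sup>2 * (a - b)\<^sup>2 = (qh - inverse qh)\<^sup>2 * (a + b)\<^sup>2 + k"
      using k[OF s0, unfolded step \<kappa>_sq, folded x_def, unfolded x]
      by (simp only: power_mult_distrib)
    then have "k = - 4 * (qh - inverse qh)\<^sup>2 * \<Pi>"
      by (simp add: \<Pi> power2_eq_square algebra_simps)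
    then show ?thesis
      by (simp add: \<kappa>_sq[symmetric])
  qed
  have D_at: "poly (D p) (X s - c) * (X (s + h / 2) - X (s - h / 2))
      = poly p (X (s + h / 2) - c) - poly p (X (s - h / 2) - c)" if "s \<in> U" for p s
    using divdiff_at[OF X that, of "pcompose p [:- c, 1:]"] by (simp add: D_def poly_pcompose)
  have S_at: "2 * poly (S p) (X s - c)
      = poly p (X (s + h / 2) - c) + poly p (X (s - h / 2) - c)" if "s \<in> U" for p s
    using average_at[OF X \<eta>\<beta> that, of "pcompose p [:- c, 1:]"] by (simp add: S_def poly_pcompose)
  note nz = admissible_step[OF X]
  have inf: "infinite ((\<lambda>s. X s - c) ` U)"
  proof
    assume "finite ((\<lambda>s. X s - c) ` U)"
    then have "finite ((\<lambda>x. x + c) ` (\<lambda>s. X s - c) ` U)"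
      by (rule finite_imageI)
    then show False
      using admissible_infinite[OF X] by (simp add: image_image)
  qed
  have \<alpha>': "\<alpha> n = (qh ^ n + inverse qh ^ n) / 2" for n
    by (simp add: \<alpha> power_int_minus power_inverse)
  have \<gamma>': "\<gamma> n = (qh ^ n - inverse qh ^ n) / (qh - inverse qh)" for n
    by (simp add: \<gamma> power_int_minus power_inverse)
  have \<kappa>\<alpha>: "\<alpha> 1 = \<kappa>"
    by (simp add: \<alpha>' \<eta>_eq[symmetric])
  have \<alpha>_Suc: "\<alpha> (Suc n) = \<kappa> * \<alpha> n + (\<kappa>\<^sup>2 - 1) * \<gamma> n" for n
  proof -
    have "4 * (\<kappa> * \<alpha> n + (\<kappa>\<^sup>2 - 1) * \<gamma> n)
        = (2 * \<kappa>) * (2 * \<alpha> n) + (4 * (\<kappa>\<^sup>2 - 1)) * \<gamma> n"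
      by (simp add: algebra_simps)
    also have "\<dots> = (qh + inverse qh) * (qh ^ n + inverse qh ^ n)
        + (qh - inverse qh) * (qh ^ n - inverse qh ^ n)"
      unfolding \<kappa>_sq \<eta>_eq using \<delta> by (simp add: \<alpha>' \<gamma>' power2_eq_square)
    also have "\<dots> = 4 * \<alpha> (Suc n)"
      by (simp add: \<alpha>' algebra_simps)
    finally show ?thesis
      unfolding mult_cancel_left by simp
  qed
  have \<gamma>_Suc: "\<gamma> (Suc n) = \<alpha> n + \<kappa> * \<gamma> n" for n
  proof -
    have "2 * (\<alpha> n + \<kappa> * \<gamma> n) * (qh - inverse qh)
        = (2 * \<alpha> n) * (qh - inverse qh) + (2 * \<kappa>) * (\<gamma> n * (qh - inverse qh))"
      by (simp add: algebra_simps)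
    also have "\<dots> = (qh ^ n + inverse qh ^ n) * (qh - inverse qh)
        + (qh + inverse qh) * (qh ^ n - inverse qh ^ n)"
      unfolding \<eta>_eq using \<delta> by (simp add: \<alpha>' \<gamma>')
    also have "\<dots> = 2 * (qh ^ Suc n - inverse qh ^ Suc n)"
      by (simp add: algebra_simps)
    also have "\<dots> = 2 * \<gamma> (Suc n) * (qh - inverse qh)"
      using \<delta> by (simp add: \<gamma>')
    finally show ?thesis
      using \<delta> unfolding mult_cancel_right mult_cancel_left by simp
  qed
  have \<gamma>_nonzero: "\<gamma> j \<noteq> 0" if "1 \<le> j" "j \<le> N + 1" for j
  proof
    assume "\<gamma> j = 0"
    then have "qh ^ j = inverse (qh ^ j)"
      using \<delta> by (simp add: \<gamma>' power_inverse)
    then have "qh ^ j * qh ^ j = 1"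
      using qh0 by (metis power_not_zero right_inverse)
    then have "q ^ j = 1"
      by (simp add: qh(1)[symmetric] power2_eq_square power_mult_distrib)
    then show False
      using primitive(1) that N by (auto simp: primitive_root_of_unity_def)
  qed
  have \<phi>': "pcompose [:\<phi>0', \<phi>1', \<phi>2:] [:- c, 1:] = \<phi>" and \<psi>': "pcompose [:\<psi>0', \<psi>1:] [:- c, 1:] = \<psi>"
    by (simp_all add: \<phi>0'_def \<phi>1'_def \<psi>0'_def \<phi> \<psi> pcompose_pCons pderiv_pCons algebra_simps)
  interpret centred_lattice h U "\<lambda>s. X s - c" \<kappa> \<Pi> D S
    by unfold_locales (use up down inf nz sum k D_at S_at in \<open>auto simp: k_eq algebra_simps\<close>)
  have pearson: "u' (E [:\<phi>0', \<phi>1', \<phi>2:] [:\<psi>0', \<psi>1:] p) = 0" for p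
  proof -
    have "u (\<phi> * divdiff h U X f) + u (\<psi> * average h U X f) = 0" for f
      using fun_cong[OF equation, of f]
      by (simp add: divdiff_dual_def average_dual_def mult_functional_def add_eq_0_iff)
    moreover have "pcompose (E [:\<phi>0', \<phi>1', \<phi>2:] [:\<psi>0', \<psi>1:] p) [:- c, 1:]
        = \<phi> * divdiff h U X (pcompose p [:- c, 1:]) + \<psi> * average h U X (pcompose p [:- c, 1:])"
      unfolding E_def pcompose_add pcompose_mult \<phi>' \<psi>' D_def S_def pcompose_shift_inverse ..
    ultimately show ?thesis
      by (simp add: u'_def functional_add[OF u(1)])
  qed
  interpret regular_pearson_ladder h U "\<lambda>s. X s - c" \<kappa> \<Pi> D S \<alpha> \<gamma> d e \<phi>0' \<phi>1' \<phi>2 \<psi>0' \<psi>1 u' N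
  proof unfold_locales
    show "functional u'"
      unfolding u'_def by (rule functional_shift[OF u(1)])
    show "e n = \<phi>1' * \<gamma> n + \<psi>0' * \<alpha> n" for n
      by (simp add: e \<phi>1'_def \<psi>0'_def \<phi> \<psi> pderiv_pCons algebra_simps)
  qed (use u(2) \<kappa> d_nonzero pearson \<alpha>_Suc \<gamma>_Suc \<gamma>_nonzero in
      \<open>auto simp: d \<alpha>' \<gamma>' u'_def pcompose_1\<close>)
  have v_eq: "v n = \<phi>n n (c - e n / d (2 * n))" for n
    unfolding v_def \<Phi>_def top_coeff_def \<phi>n \<kappa>\<alpha>
    by (simp add: \<phi>0'_def[symmetric] \<phi>1'_def[symmetric] \<psi>0'_def[symmetric]
        power2_eq_square algebra_simps)
  have regular: "regular_of_order (N + 2) u \<longleftrightarrow> (\<forall>n\<le>N. \<phi>n n (c - e n / d (2 * n)) \<noteq> 0)"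
    using regular_iff regular_of_order_shift[of "N + 2" u c] by (simp add: u'_def[abs_def] v_eq)
  have index: "{..N + 1} = {..<N + 2}"
    by auto
  have Bn': "Bn n = c + (\<gamma> n * e (n - 1) / d (2 * n - 2) - \<gamma> (n + 1) * e n / d (2 * n))" if "n \<le> N" for n
    using Bn[of n] B0 that by (cases "n = 0") (auto simp: \<gamma>_0)
  have Cn': "Cn (n + 1) = - (\<gamma> (n + 1) * d (n - 1) / (d (2 * n - 1) * d (2 * n + 1))) * v n"
    if "n \<le> N" for n
    using Cn[of n] C1 d_nonzero that by (cases "n = 0") (auto simp: v_eq)
  have props: "P 0 = 1 \<and>
         (\<forall>n \<le> N. P (n + 1) = [:- Bn n, 1:] * P n
                     - (if n = 0 then 0 else smult (Cn n) (P (n - 1)))) \<and>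
         Cn (N + 1) = u (P (N + 1) ^ 2) / u (P N ^ 2)"
    if P: "monic_orthogonal_family {..N + 1} u P" for P
  proof (intro conjI allI impI)
    define Q where "Q n = pcompose (P n) [:c, 1:]" for n
    have Q: "monic_orthogonal_family {..<N + 2} u' Q"
      using monic_orthogonal_family_shift[OF P, of c] unfolding u'_def[abs_def] Q_def[abs_def] index .
    have P_Q: "P n = pcompose (Q n) [:- c, 1:]" for n
      by (simp add: Q_def pcompose_shift_inverse)
    have "degree (P 0) = 0" "lead_coeff (P 0) = 1"
      using P by (auto simp: monic_orthogonal_family_def orthogonal_family_def)
    then show "P 0 = 1"
      by (metis degree_0_id of_nat_1 one_pCons degree_eq_zeroE lead_coeff_pCons(2) pCons_0_0)
    show "P (n + 1) = [:- Bn n, 1:] * P n - (if n = 0 then 0 else smult (Cn n) (P (n - 1)))"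
      if n: "n \<le> N" for n
    proof -
      have "Cn n = - (\<gamma> n * d (n - 2) / (d (2 * n - 3) * d (2 * n - 1))) * v (n - 1)" if "n \<noteq> 0"
        using Cn'[of "n - 1"] n that by (cases n) (auto simp: numeral_3_eq_3 numeral_2_eq_2)
      then have rest: "pcompose (if n = 0 then 0
          else smult (- (\<gamma> n * d (n - 2) / (d (2 * n - 3) * d (2 * n - 1))) * v (n - 1)) (Q (n - 1)))
          [:- c, 1:] = (if n = 0 then 0 else smult (Cn n) (P (n - 1)))"
        by (cases "n = 0") (simp_all only: P_Q pcompose_smult pcompose_0 simp_thms if_True if_False)
      have factor: "pcompose [:- r, 1:] [:- c, 1:] = [:- (c + r), 1:]" for r
        by (simp add: pcompose_pCons)
      show ?thesis
        unfolding P_Q[of "n + 1"] recurrence[OF Q n] Bn'[OF n] pcompose_diff pcompose_mult factor rest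
          P_Q[of n, symmetric] ..
    qed
    have "u (P n ^ 2) = u' (Q n ^ 2)" for n
      by (simp add: u'_def Q_def power2_eq_square pcompose_mult pcompose_shift_inverse)
    then show "Cn (N + 1) = u (P (N + 1) ^ 2) / u (P N ^ 2)"
      using norm_ratio[OF Q, of N] Cn'[of N] by simp
  qed
  have "\<exists>P. monic_orthogonal_family {..N + 1} u P" if "regular_of_order (N + 2) u"
    using that monic_orthogonal_familyI[OF u(1)] unfolding regular_of_order_def index by blast
  with regular props show ?thesis
    by blast
qed

end
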